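(* Let $H\in\Theta$, $X=\{x_1,\dots,x_n\}\in\Gamma$, and let $s:W(X^0)\to W(X)$ be a special homomorphism. Then for every $X$-special formula $u\in\Phi(X^0)$ and every point $\mu:W(X)\to H$ we have $u\in\mathrm{Tp}^H(\mu)$ if and only if $s_*u\in\mathrm{LKer}(\mu)$.
   Context: Fix a variety $\Theta$, an infinite set of variables $X^0$, let $\Gamma$ be the set of finite subsets of $X^0$ and $\Gamma^*=\Gamma\cup\{X^0\}$; $W(X)$ is the free algebra of $\Theta$ over $X$. For $H\in\Theta$ and $X\in\Gamma^*$, $\mathrm{Hal}^X_\Theta(H)$ is the Boolean algebra of subsets of $\mathrm{Hom}(W(X),H)$ with quantifiers ($\mu\in\exists xA$ iff some $\nu\in A$ agrees with $\mu$ off $x$), equalities $[w\equiv w']_H=\{\mu:\mu(w)=\mu(w')\}$ and maps $s_*(A)=\{\mu:\mu\circ s\in A\}$ for homomorphisms $s:W(X)\to W(Y)$. The multi-sorted algebra of formulas $\Phi=(\Phi(X),X\in\Gamma^* )$ is the free Halmos algebra over the sets of formal equalities $w\equiv w'$, $w,w'\in W(X)$ (Halmos algebras: each sort an extended Boolean algebra with commuting quantifiers $\exists x$ and equalities $w\equiv w'$, operations $s_*$ for homomorphisms $s$ that are Boolean homomorphisms, functorial, and compatible with quantifiers and equalities); $\mathrm{Val}^X_H:\Phi(X)\to\mathrm{Hal}^X_\Theta(H)$ are the components of the unique homomorphism sending $w\equiv w'$ to $[w\equiv w']_H$. A point $\mu$ satisfies $u\in\Phi(X)$ iff $\mu\in\mathrm{Val}^X_H(u)$;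 $\mathrm{LKer}(\mu)$ is the set of formulas satisfied by $\mu$. The component $\Phi(X^0)$ is the Lindenbaum–Tarski algebra of first-order formulas with equalities in the signature of $\Theta$ over the variables $X^0$, so free and bound occurrences of variables make sense for its elements. For $X\in\Gamma$, a formula $u\in\Phi(X^0)$ is $X$-special if all its free variables lie in $X$ and all its bound variables lie in $X^0\setminus X$. For a point $\mu:W(X)\to H$, its type $\mathrm{Tp}^H(\mu)$ is the set of $X$-special $u$ such that the sentence obtained by substituting $a_i=\mu(x_i)$ for $x_i$ holds in $H$; equivalently, every point $\eta:W(X^0)\to H$ with $\eta(x_i)=\mu(x_i)$ for all $i$ satisfies $u$. A homomorphism $s:W(X^0)\to W(X)$ is special if $s(x)=x$ for all $x\in X$; it induces $s_*:\Phi(X^0)\to\Phi(X)$. *)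

theory Defs
  imports Main "HOL-Library.FuncSet"
begin

section \<open>Varieties and their free algebras\<close>

datatype ('f, 'v) tm = Var 'v | Op 'f "('f, 'v) tm list"

text \<open>A variety is presented by a signature and a set of identities. An identity involves finitely
  many variables, so countably many variables suffice for writing identities.\<close>

record 'f variety =
  ops :: "'f set"
  ar :: "'f \<Rightarrow> nat"
  idents :: "(('f, nat) tm \<times> ('f, nat) tm) set"

inductive_set Tm :: "'f variety \<Rightarrow> 'v set \<Rightarrow> ('f, 'v) tm set" for \<Theta> X where
  Var: "x \<in> X \<Longrightarrow> Var x \<in> Tm \<Theta> X"
| Op: "f \<in> ops \<Theta> \<Longrightarrow> length ts = ar \<Theta> f \<Longrightarrow> (\<And>t. t \<in> set ts \<Longrightarrow> t \<in> Tm \<Theta> X) \<Longrightarrow> Op f ts \<in> Tm \<Theta> X"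

definition is_variety :: "'f variety \<Rightarrow> bool" where
  "is_variety \<Theta> \<longleftrightarrow> idents \<Theta> \<subseteq> Tm \<Theta> UNIV \<times> Tm \<Theta> UNIV"

primrec tvars :: "('f, 'v) tm \<Rightarrow> 'v set" where
  "tvars (Var x) = {x}"
| "tvars (Op f ts) = \<Union> (set (map tvars ts))"

primrec evalt :: "('f \<Rightarrow> 'a list \<Rightarrow> 'a) \<Rightarrow> ('v \<Rightarrow> 'a) \<Rightarrow> ('f, 'v) tm \<Rightarrow> 'a" where
  "evalt I \<rho> (Var x) = \<rho> x"
| "evalt I \<rho> (Op f ts) = I f (map (evalt I \<rho>) ts)"

text \<open>Carriers may be empty, because the free algebra over the empty set of variables is empty
  when there are no constants.\<close>

record ('f, 'a) alg =
  carr :: "'a set"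
  interp :: "'f \<Rightarrow> 'a list \<Rightarrow> 'a"

definition in_variety :: "'f variety \<Rightarrow> ('f, 'a) alg \<Rightarrow> bool" where
  "in_variety \<Theta> A \<longleftrightarrow>
     (\<forall>f \<in> ops \<Theta>. \<forall>as. length as = ar \<Theta> f \<and> set as \<subseteq> carr A \<longrightarrow> interp A f as \<in> carr A) \<and>
     (\<forall>(l, r) \<in> idents \<Theta>. \<forall>\<rho>. range \<rho> \<subseteq> carr A \<longrightarrow> evalt (interp A) \<rho> l = evalt (interp A) \<rho> r)"

definition Hom :: "'f variety \<Rightarrow> ('f, 'a) alg \<Rightarrow> ('f, 'b) alg \<Rightarrow> ('a \<Rightarrow> 'b) set" where
  "Hom \<Theta> A B = {h \<in> carr A \<rightarrow>\<^sub>E carr B.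
     \<forall>f \<in> ops \<Theta>. \<forall>as. length as = ar \<Theta> f \<and> set as \<subseteq> carr A \<longrightarrow>
       h (interp A f as) = interp B f (map h as)}"

text \<open>The congruence on terms over \<open>X\<close> generated by all substitution instances of the
  identities; \<open>evalt Op \<sigma>\<close> is the substitution of \<open>\<sigma>\<close>.\<close>

inductive eqt :: "'f variety \<Rightarrow> 'v set \<Rightarrow> ('f, 'v) tm \<Rightarrow> ('f, 'v) tm \<Rightarrow> bool" for \<Theta> X where
  refl: "t \<in> Tm \<Theta> X \<Longrightarrow> eqt \<Theta> X t t"
| sym: "eqt \<Theta> X t u \<Longrightarrow> eqt \<Theta> X u t"
| trans: "eqt \<Theta> X t u \<Longrightarrow> eqt \<Theta> X u v \<Longrightarrow> eqt \<Theta> X t v"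
| cong: "f \<in> ops \<Theta> \<Longrightarrow> length ts = ar \<Theta> f \<Longrightarrow> list_all2 (eqt \<Theta> X) ts us \<Longrightarrow>
    eqt \<Theta> X (Op f ts) (Op f us)"
| ident: "(l, r) \<in> idents \<Theta> \<Longrightarrow> range \<sigma> \<subseteq> Tm \<Theta> X \<Longrightarrow> eqt \<Theta> X (evalt Op \<sigma> l) (evalt Op \<sigma> r)"

definition tcls :: "'f variety \<Rightarrow> 'v set \<Rightarrow> ('f, 'v) tm \<Rightarrow> ('f, 'v) tm set" where
  "tcls \<Theta> X t = {u. eqt \<Theta> X t u}"

definition W :: "'f variety \<Rightarrow> 'v set \<Rightarrow> ('f, ('f, 'v) tm set) alg" where
  "W \<Theta> X = \<lparr>carr = tcls \<Theta> X ` Tm \<Theta> X,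
     interp = (\<lambda>f cs. {u. \<exists>ts. list_all2 (\<in>) ts cs \<and> eqt \<Theta> X (Op f ts) u})\<rparr>"

abbreviation gen :: "'f variety \<Rightarrow> 'v set \<Rightarrow> 'v \<Rightarrow> ('f, 'v) tm set" where
  "gen \<Theta> X x \<equiv> tcls \<Theta> X (Var x)"

section \<open>Halmos algebras\<close>

definition Gam :: "'v set \<Rightarrow> 'v set set" where
  "Gam X0 = {X. finite X \<and> X \<subseteq> X0}"

definition Gams :: "'v set \<Rightarrow> 'v set set" where
  "Gams X0 = insert X0 (Gam X0)"

text \<open>\<open>hsub L X Y s\<close> is the operation \<open>s\<^sub>*\<close> from sort \<open>X\<close> to sort \<open>Y\<close> for a homomorphism
  \<open>s\<close> from \<open>W(X)\<close> to \<open>W(Y)\<close>.\<close>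

record ('f, 'v, 'b) halmos =
  hdom :: "'v set \<Rightarrow> 'b set"
  hbot :: "'v set \<Rightarrow> 'b"
  htop :: "'v set \<Rightarrow> 'b"
  hneg :: "'v set \<Rightarrow> 'b \<Rightarrow> 'b"
  hmeet :: "'v set \<Rightarrow> 'b \<Rightarrow> 'b \<Rightarrow> 'b"
  hjoin :: "'v set \<Rightarrow> 'b \<Rightarrow> 'b \<Rightarrow> 'b"
  hex :: "'v set \<Rightarrow> 'v \<Rightarrow> 'b \<Rightarrow> 'b"
  heq :: "'v set \<Rightarrow> ('f, 'v) tm set \<Rightarrow> ('f, 'v) tm set \<Rightarrow> 'b"
  hsub :: "'v set \<Rightarrow> 'v set \<Rightarrow> (('f, 'v) tm set \<Rightarrow> ('f, 'v) tm set) \<Rightarrow> 'b \<Rightarrow> 'b"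

definition boolean_sort :: "('f, 'v, 'b) halmos \<Rightarrow> 'v set \<Rightarrow> bool" where
  "boolean_sort L X \<longleftrightarrow>
     hbot L X \<in> hdom L X \<and> htop L X \<in> hdom L X \<and>
     (\<forall>a \<in> hdom L X. hneg L X a \<in> hdom L X \<and>
        hmeet L X a (htop L X) = a \<and> hjoin L X a (hbot L X) = a \<and>
        hmeet L X a (hneg L X a) = hbot L X \<and> hjoin L X a (hneg L X a) = htop L X) \<and>
     (\<forall>a \<in> hdom L X. \<forall>b \<in> hdom L X.
        hmeet L X a b \<in> hdom L X \<and> hjoin L X a b \<in> hdom L X \<and>
        hmeet L X a b = hmeet L X b a \<and> hjoin L X a b = hjoin L X b a) \<and>
     (\<forall>a \<in> hdom L X. \<forall>b \<in> hdom L X. \<forall>c \<in> hdom L X.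
        hmeet L X a (hjoin L X b c) = hjoin L X (hmeet L X a b) (hmeet L X a c) \<and>
        hjoin L X a (hmeet L X b c) = hmeet L X (hjoin L X a b) (hjoin L X a c))"

text \<open>The order of the Boolean algebra is expressed by meets: \<open>a \<le> b\<close> is \<open>a \<sqinter> b = a\<close>.
  The last clause says that equality is compatible with the operations of the signature.\<close>

definition extended_boolean_sort :: "'f variety \<Rightarrow> ('f, 'v, 'b) halmos \<Rightarrow> 'v set \<Rightarrow> bool" where
  "extended_boolean_sort \<Theta> L X \<longleftrightarrow>
     boolean_sort L X \<and>
     (\<forall>x \<in> X. hex L X x (hbot L X) = hbot L X) \<and>
     (\<forall>x \<in> X. \<forall>a \<in> hdom L X. hex L X x a \<in> hdom L X \<and> hmeet L X a (hex L X x a) = a) \<and>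
     (\<forall>x \<in> X. \<forall>a \<in> hdom L X. \<forall>b \<in> hdom L X.
        hex L X x (hmeet L X a (hex L X x b)) = hmeet L X (hex L X x a) (hex L X x b)) \<and>
     (\<forall>x \<in> X. \<forall>y \<in> X. \<forall>a \<in> hdom L X. hex L X x (hex L X y a) = hex L X y (hex L X x a)) \<and>
     (\<forall>w \<in> carr (W \<Theta> X). \<forall>w' \<in> carr (W \<Theta> X). heq L X w w' \<in> hdom L X) \<and>
     (\<forall>w \<in> carr (W \<Theta> X). heq L X w w = htop L X) \<and>
     (\<forall>f \<in> ops \<Theta>. \<forall>ws ws'. length ws = ar \<Theta> f \<and> length ws' = ar \<Theta> f \<and>
        set ws \<subseteq> carr (W \<Theta> X) \<and> set ws' \<subseteq> carr (W \<Theta> X) \<longrightarrow>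
        (let e = foldr (hmeet L X) (map2 (heq L X) ws ws') (htop L X)
         in hmeet L X e (heq L X (interp (W \<Theta> X) f ws) (interp (W \<Theta> X) f ws')) = e))"

text \<open>The support of \<open>w \<in> W(Y)\<close> omits \<open>y\<close> iff some term representing \<open>w\<close> omits \<open>y\<close>.
  Accordingly \<open>fresh_subst\<close> is the side condition under which \<open>s\<^sub>*\<exists>x a = \<exists>y s\<^sub>*a\<close>:
  the variable \<open>y\<close> is \<open>s(x)\<close>, and \<open>y\<close> is not in the support of \<open>s(x')\<close> for any other
  \<open>x' \<in> X\<close>.\<close>

definition fresh_subst ::
  "'f variety \<Rightarrow> 'v set \<Rightarrow> 'v set \<Rightarrow> (('f, 'v) tm set \<Rightarrow> ('f, 'v) tm set) \<Rightarrow> 'v \<Rightarrow> 'v \<Rightarrow> bool" where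
  "fresh_subst \<Theta> X Y s x y \<longleftrightarrow> x \<in> X \<and> y \<in> Y \<and> s (gen \<Theta> X x) = gen \<Theta> Y y \<and>
     (\<forall>x' \<in> X - {x}. \<exists>t \<in> s (gen \<Theta> X x'). y \<notin> tvars t)"

text \<open>\<open>agree_off \<Theta> X x \<mu> \<nu>\<close>: the homomorphisms \<open>\<mu>\<close>, \<open>\<nu>\<close> defined on \<open>W(X)\<close>
  coincide on all variables other than \<open>x\<close>.\<close>

definition agree_off ::
  "'f variety \<Rightarrow> 'v set \<Rightarrow> 'v \<Rightarrow> (('f, 'v) tm set \<Rightarrow> 'a) \<Rightarrow> (('f, 'v) tm set \<Rightarrow> 'a) \<Rightarrow> bool" where
  "agree_off \<Theta> X x \<mu> \<nu> \<longleftrightarrow> (\<forall>y \<in> X - {x}. \<mu> (gen \<Theta> X y) = \<nu> (gen \<Theta> X y))"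

text \<open>\<open>one_subst \<Theta> X x w s\<close>: \<open>s\<close> is the endomorphism of \<open>W(X)\<close> that sends \<open>x\<close> to \<open>w\<close>
  and fixes the other variables.\<close>

definition one_subst ::
  "'f variety \<Rightarrow> 'v set \<Rightarrow> 'v \<Rightarrow> ('f, 'v) tm set \<Rightarrow> (('f, 'v) tm set \<Rightarrow> ('f, 'v) tm set) \<Rightarrow> bool" where
  "one_subst \<Theta> X x w s \<longleftrightarrow> s \<in> Hom \<Theta> (W \<Theta> X) (W \<Theta> X) \<and> s (gen \<Theta> X x) = w \<and>
     (\<forall>y \<in> X - {x}. s (gen \<Theta> X y) = gen \<Theta> X y)"

definition boolean_hom_between ::
  "('f, 'v, 'b) halmos \<Rightarrow> 'v set \<Rightarrow> ('f, 'v, 'c) halmos \<Rightarrow> 'v set \<Rightarrow> ('b \<Rightarrow> 'c) \<Rightarrow> bool" where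
  "boolean_hom_between L X L' Y h \<longleftrightarrow>
     h (hbot L X) = hbot L' Y \<and> h (htop L X) = htop L' Y \<and>
     (\<forall>a \<in> hdom L X. h a \<in> hdom L' Y \<and> h (hneg L X a) = hneg L' Y (h a)) \<and>
     (\<forall>a \<in> hdom L X. \<forall>b \<in> hdom L X.
        h (hmeet L X a b) = hmeet L' Y (h a) (h b) \<and> h (hjoin L X a b) = hjoin L' Y (h a) (h b))"

definition halmos_algebra :: "'f variety \<Rightarrow> 'v set \<Rightarrow> ('f, 'v, 'b) halmos \<Rightarrow> bool" where
  "halmos_algebra \<Theta> X0 L \<longleftrightarrow>
     (\<forall>X \<in> Gams X0. extended_boolean_sort \<Theta> L X) \<and>
     (\<forall>X \<in> Gams X0. \<forall>Y \<in> Gams X0. \<forall>s \<in> Hom \<Theta> (W \<Theta> X) (W \<Theta> Y).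
        boolean_hom_between L X L Y (hsub L X Y s)) \<and>
     (\<forall>X \<in> Gams X0. \<forall>a \<in> hdom L X. hsub L X X (\<lambda>w \<in> carr (W \<Theta> X). w) a = a) \<and>
     (\<forall>X \<in> Gams X0. \<forall>Y \<in> Gams X0. \<forall>Z \<in> Gams X0.
        \<forall>s \<in> Hom \<Theta> (W \<Theta> X) (W \<Theta> Y). \<forall>s' \<in> Hom \<Theta> (W \<Theta> Y) (W \<Theta> Z). \<forall>a \<in> hdom L X.
        hsub L X Z (compose (carr (W \<Theta> X)) s' s) a = hsub L Y Z s' (hsub L X Y s a)) \<and>
     (\<forall>X \<in> Gams X0. \<forall>Y \<in> Gams X0.
        \<forall>s \<in> Hom \<Theta> (W \<Theta> X) (W \<Theta> Y). \<forall>s' \<in> Hom \<Theta> (W \<Theta> X) (W \<Theta> Y). \<forall>x \<in> X. \<forall>a \<in> hdom L X.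
        agree_off \<Theta> X x s s' \<longrightarrow> hsub L X Y s (hex L X x a) = hsub L X Y s' (hex L X x a)) \<and>
     (\<forall>X \<in> Gams X0. \<forall>Y \<in> Gams X0. \<forall>s \<in> Hom \<Theta> (W \<Theta> X) (W \<Theta> Y). \<forall>x y. \<forall>a \<in> hdom L X.
        fresh_subst \<Theta> X Y s x y \<longrightarrow> hsub L X Y s (hex L X x a) = hex L Y y (hsub L X Y s a)) \<and>
     (\<forall>X \<in> Gams X0. \<forall>Y \<in> Gams X0. \<forall>s \<in> Hom \<Theta> (W \<Theta> X) (W \<Theta> Y).
        \<forall>w \<in> carr (W \<Theta> X). \<forall>w' \<in> carr (W \<Theta> X).
        hsub L X Y s (heq L X w w') = heq L Y (s w) (s w')) \<and>
     (\<forall>X \<in> Gams X0. \<forall>x \<in> X. \<forall>w \<in> carr (W \<Theta> X). \<forall>w' \<in> carr (W \<Theta> X). \<forall>s s'. \<forall>a \<in> hdom L X.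
        one_subst \<Theta> X x w s \<and> one_subst \<Theta> X x w' s' \<longrightarrow>
        (let e = hmeet L X (hsub L X X s a) (heq L X w w')
         in hmeet L X e (hsub L X X s' a) = e))"

text \<open>Homomorphisms of Halmos algebras preserve the equalities, which are nullary operations.
  They are taken extensional, so that uniqueness makes sense.\<close>

definition halmos_hom ::
  "'f variety \<Rightarrow> 'v set \<Rightarrow> ('f, 'v, 'b) halmos \<Rightarrow> ('f, 'v, 'c) halmos \<Rightarrow> ('v set \<Rightarrow> 'b \<Rightarrow> 'c) \<Rightarrow> bool" where
  "halmos_hom \<Theta> X0 L L' h \<longleftrightarrow>
     h \<in> (\<Pi>\<^sub>E X \<in> Gams X0. hdom L X \<rightarrow>\<^sub>E hdom L' X) \<and>
     (\<forall>X \<in> Gams X0. boolean_hom_between L X L' X (h X)) \<and>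
     (\<forall>X \<in> Gams X0. \<forall>x \<in> X. \<forall>a \<in> hdom L X. h X (hex L X x a) = hex L' X x (h X a)) \<and>
     (\<forall>X \<in> Gams X0. \<forall>w \<in> carr (W \<Theta> X). \<forall>w' \<in> carr (W \<Theta> X). h X (heq L X w w') = heq L' X w w') \<and>
     (\<forall>X \<in> Gams X0. \<forall>Y \<in> Gams X0. \<forall>s \<in> Hom \<Theta> (W \<Theta> X) (W \<Theta> Y). \<forall>a \<in> hdom L X.
        h Y (hsub L X Y s a) = hsub L' X Y s (h X a))"

definition Hal :: "'f variety \<Rightarrow> ('f, 'h) alg \<Rightarrow> ('f, 'v, (('f, 'v) tm set \<Rightarrow> 'h) set) halmos" where
  "Hal \<Theta> H = \<lparr>
     hdom = (\<lambda>X. Pow (Hom \<Theta> (W \<Theta> X) H)),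
     hbot = (\<lambda>X. {}),
     htop = (\<lambda>X. Hom \<Theta> (W \<Theta> X) H),
     hneg = (\<lambda>X A. Hom \<Theta> (W \<Theta> X) H - A),
     hmeet = (\<lambda>X A B. A \<inter> B),
     hjoin = (\<lambda>X A B. A \<union> B),
     hex = (\<lambda>X x A. {\<mu> \<in> Hom \<Theta> (W \<Theta> X) H. \<exists>\<nu> \<in> A. agree_off \<Theta> X x \<mu> \<nu>}),
     heq = (\<lambda>X w w'. {\<mu> \<in> Hom \<Theta> (W \<Theta> X) H. \<mu> w = \<mu> w'}),
     hsub = (\<lambda>X Y s A. {\<mu> \<in> Hom \<Theta> (W \<Theta> Y) H. compose (carr (W \<Theta> X)) \<mu> s \<in> A})\<rparr>"

section \<open>The algebra of formulas\<close>

text \<open>Terms in the signature of Halmos algebras, built from the formal equalities. The target sort of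
  \<open>HSub X s p\<close> is not recorded: sortedness and the congruence below are indexed by it.\<close>

datatype ('f, 'v) hterm =
    HEq "('f, 'v) tm set" "('f, 'v) tm set"
  | HBot
  | HTop
  | HNeg "('f, 'v) hterm"
  | HMeet "('f, 'v) hterm" "('f, 'v) hterm"
  | HJoin "('f, 'v) hterm" "('f, 'v) hterm"
  | HEx 'v "('f, 'v) hterm"
  | HSub "'v set" "('f, 'v) tm set \<Rightarrow> ('f, 'v) tm set" "('f, 'v) hterm"

primrec of_sort :: "'f variety \<Rightarrow> 'v set \<Rightarrow> ('f, 'v) hterm \<Rightarrow> 'v set \<Rightarrow> bool" where
  "of_sort \<Theta> X0 (HEq w w') X \<longleftrightarrow> w \<in> carr (W \<Theta> X) \<and> w' \<in> carr (W \<Theta> X)"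
| "of_sort \<Theta> X0 HBot X \<longleftrightarrow> True"
| "of_sort \<Theta> X0 HTop X \<longleftrightarrow> True"
| "of_sort \<Theta> X0 (HNeg p) X \<longleftrightarrow> of_sort \<Theta> X0 p X"
| "of_sort \<Theta> X0 (HMeet p q) X \<longleftrightarrow> of_sort \<Theta> X0 p X \<and> of_sort \<Theta> X0 q X"
| "of_sort \<Theta> X0 (HJoin p q) X \<longleftrightarrow> of_sort \<Theta> X0 p X \<and> of_sort \<Theta> X0 q X"
| "of_sort \<Theta> X0 (HEx x p) X \<longleftrightarrow> x \<in> X \<and> of_sort \<Theta> X0 p X"
| "of_sort \<Theta> X0 (HSub Y s p) X \<longleftrightarrow> Y \<in> Gams X0 \<and> s \<in> Hom \<Theta> (W \<Theta> Y) (W \<Theta> X) \<and> of_sort \<Theta> X0 p Y"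

text \<open>The instances in sort \<open>X\<close> of the identities in the definition of
  \<^const>\<open>halmos_algebra\<close>, in the same order. They are used only for terms of sort \<open>X\<close>.\<close>

inductive hax :: "'f variety \<Rightarrow> 'v set \<Rightarrow> ('f, 'v) hterm \<Rightarrow> ('f, 'v) hterm \<Rightarrow> bool" for \<Theta> X where
  meet_top: "hax \<Theta> X (HMeet p HTop) p"
| join_bot: "hax \<Theta> X (HJoin p HBot) p"
| meet_neg: "hax \<Theta> X (HMeet p (HNeg p)) HBot"
| join_neg: "hax \<Theta> X (HJoin p (HNeg p)) HTop"
| meet_comm: "hax \<Theta> X (HMeet p q) (HMeet q p)"
| join_comm: "hax \<Theta> X (HJoin p q) (HJoin q p)"
| meet_join: "hax \<Theta> X (HMeet p (HJoin q r)) (HJoin (HMeet p q) (HMeet p r))"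
| join_meet: "hax \<Theta> X (HJoin p (HMeet q r)) (HMeet (HJoin p q) (HJoin p r))"
| ex_bot: "hax \<Theta> X (HEx x HBot) HBot"
| ex_incr: "hax \<Theta> X (HMeet p (HEx x p)) p"
| ex_meet: "hax \<Theta> X (HEx x (HMeet p (HEx x q))) (HMeet (HEx x p) (HEx x q))"
| ex_comm: "hax \<Theta> X (HEx x (HEx y p)) (HEx y (HEx x p))"
| eq_refl: "hax \<Theta> X (HEq w w) HTop"
| eq_op: "f \<in> ops \<Theta> \<Longrightarrow> length ws = ar \<Theta> f \<Longrightarrow> length ws' = ar \<Theta> f \<Longrightarrow>
    set ws \<subseteq> carr (W \<Theta> X) \<Longrightarrow> set ws' \<subseteq> carr (W \<Theta> X) \<Longrightarrow>
    e = foldr HMeet (map2 HEq ws ws') HTop \<Longrightarrow>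
    hax \<Theta> X (HMeet e (HEq (interp (W \<Theta> X) f ws) (interp (W \<Theta> X) f ws'))) e"
| sub_bot: "hax \<Theta> X (HSub Y s HBot) HBot"
| sub_top: "hax \<Theta> X (HSub Y s HTop) HTop"
| sub_neg: "hax \<Theta> X (HSub Y s (HNeg p)) (HNeg (HSub Y s p))"
| sub_meet: "hax \<Theta> X (HSub Y s (HMeet p q)) (HMeet (HSub Y s p) (HSub Y s q))"
| sub_join: "hax \<Theta> X (HSub Y s (HJoin p q)) (HJoin (HSub Y s p) (HSub Y s q))"
| sub_id: "hax \<Theta> X (HSub X (\<lambda>w \<in> carr (W \<Theta> X). w) p) p"
| sub_comp: "hax \<Theta> X (HSub Z (compose (carr (W \<Theta> Z)) s' s) p) (HSub Y s' (HSub Z s p))"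
| sub_ex_agree: "agree_off \<Theta> Y x s s' \<Longrightarrow> hax \<Theta> X (HSub Y s (HEx x p)) (HSub Y s' (HEx x p))"
| sub_ex_fresh: "fresh_subst \<Theta> Y X s x y \<Longrightarrow> hax \<Theta> X (HSub Y s (HEx x p)) (HEx y (HSub Y s p))"
| sub_eq: "hax \<Theta> X (HSub Y s (HEq w w')) (HEq (s w) (s w'))"
| sub_one: "x \<in> X \<Longrightarrow> one_subst \<Theta> X x w s \<Longrightarrow> one_subst \<Theta> X x w' s' \<Longrightarrow>
    e = HMeet (HSub X s p) (HEq w w') \<Longrightarrow> hax \<Theta> X (HMeet e (HSub X s' p)) e"

inductive hcong :: "'f variety \<Rightarrow> 'v set \<Rightarrow> 'v set \<Rightarrow> ('f, 'v) hterm \<Rightarrow> ('f, 'v) hterm \<Rightarrow> bool"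
  for \<Theta> X0 where
  ax: "hax \<Theta> X p q \<Longrightarrow> of_sort \<Theta> X0 p X \<Longrightarrow> of_sort \<Theta> X0 q X \<Longrightarrow> X \<in> Gams X0 \<Longrightarrow> hcong \<Theta> X0 X p q"
| refl: "of_sort \<Theta> X0 p X \<Longrightarrow> X \<in> Gams X0 \<Longrightarrow> hcong \<Theta> X0 X p p"
| sym: "hcong \<Theta> X0 X p q \<Longrightarrow> hcong \<Theta> X0 X q p"
| trans: "hcong \<Theta> X0 X p q \<Longrightarrow> hcong \<Theta> X0 X q r \<Longrightarrow> hcong \<Theta> X0 X p r"
| neg: "hcong \<Theta> X0 X p p' \<Longrightarrow> hcong \<Theta> X0 X (HNeg p) (HNeg p')"
| meet: "hcong \<Theta> X0 X p p' \<Longrightarrow> hcong \<Theta> X0 X q q' \<Longrightarrow> hcong \<Theta> X0 X (HMeet p q) (HMeet p' q')"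
| join: "hcong \<Theta> X0 X p p' \<Longrightarrow> hcong \<Theta> X0 X q q' \<Longrightarrow> hcong \<Theta> X0 X (HJoin p q) (HJoin p' q')"
| ex: "hcong \<Theta> X0 X p p' \<Longrightarrow> x \<in> X \<Longrightarrow> hcong \<Theta> X0 X (HEx x p) (HEx x p')"
| sub: "hcong \<Theta> X0 Y p p' \<Longrightarrow> X \<in> Gams X0 \<Longrightarrow> s \<in> Hom \<Theta> (W \<Theta> Y) (W \<Theta> X) \<Longrightarrow>
    hcong \<Theta> X0 X (HSub Y s p) (HSub Y s p')"

definition hcls :: "'f variety \<Rightarrow> 'v set \<Rightarrow> 'v set \<Rightarrow> ('f, 'v) hterm \<Rightarrow> ('f, 'v) hterm set" where
  "hcls \<Theta> X0 X p = {q. hcong \<Theta> X0 X p q}"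

definition Phi :: "'f variety \<Rightarrow> 'v set \<Rightarrow> ('f, 'v, ('f, 'v) hterm set) halmos" where
  "Phi \<Theta> X0 = \<lparr>
     hdom = (\<lambda>X. hcls \<Theta> X0 X ` {p. of_sort \<Theta> X0 p X}),
     hbot = (\<lambda>X. hcls \<Theta> X0 X HBot),
     htop = (\<lambda>X. hcls \<Theta> X0 X HTop),
     hneg = (\<lambda>X a. \<Union>p \<in> a. hcls \<Theta> X0 X (HNeg p)),
     hmeet = (\<lambda>X a b. \<Union>p \<in> a. \<Union>q \<in> b. hcls \<Theta> X0 X (HMeet p q)),
     hjoin = (\<lambda>X a b. \<Union>p \<in> a. \<Union>q \<in> b. hcls \<Theta> X0 X (HJoin p q)),
     hex = (\<lambda>X x a. \<Union>p \<in> a. hcls \<Theta> X0 X (HEx x p)),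
     heq = (\<lambda>X w w'. hcls \<Theta> X0 X (HEq w w')),
     hsub = (\<lambda>X Y s a. \<Union>p \<in> a. hcls \<Theta> X0 Y (HSub X s p))\<rparr>"

definition Val ::
  "'f variety \<Rightarrow> 'v set \<Rightarrow> ('f, 'h) alg \<Rightarrow> 'v set \<Rightarrow> ('f, 'v) hterm set \<Rightarrow> (('f, 'v) tm set \<Rightarrow> 'h) set" where
  "Val \<Theta> X0 H = (THE h. halmos_hom \<Theta> X0 (Phi \<Theta> X0) (Hal \<Theta> H) h)"

definition LKer ::
  "'f variety \<Rightarrow> 'v set \<Rightarrow> ('f, 'h) alg \<Rightarrow> 'v set \<Rightarrow> (('f, 'v) tm set \<Rightarrow> 'h) \<Rightarrow> ('f, 'v) hterm set set" where
  "LKer \<Theta> X0 H X \<mu> = {u \<in> hdom (Phi \<Theta> X0) X. \<mu> \<in> Val \<Theta> X0 H X u}"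

section \<open>First-order formulas, special formulas and types\<close>

datatype ('f, 'v) fo =
    FEq "('f, 'v) tm" "('f, 'v) tm"
  | FBot
  | FTop
  | FNeg "('f, 'v) fo"
  | FAnd "('f, 'v) fo" "('f, 'v) fo"
  | FOr "('f, 'v) fo" "('f, 'v) fo"
  | FEx 'v "('f, 'v) fo"

primrec fo_over :: "'f variety \<Rightarrow> 'v set \<Rightarrow> ('f, 'v) fo \<Rightarrow> bool" where
  "fo_over \<Theta> V (FEq t t') \<longleftrightarrow> t \<in> Tm \<Theta> V \<and> t' \<in> Tm \<Theta> V"
| "fo_over \<Theta> V FBot \<longleftrightarrow> True"
| "fo_over \<Theta> V FTop \<longleftrightarrow> True"
| "fo_over \<Theta> V (FNeg \<phi>) \<longleftrightarrow> fo_over \<Theta> V \<phi>"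
| "fo_over \<Theta> V (FAnd \<phi> \<psi>) \<longleftrightarrow> fo_over \<Theta> V \<phi> \<and> fo_over \<Theta> V \<psi>"
| "fo_over \<Theta> V (FOr \<phi> \<psi>) \<longleftrightarrow> fo_over \<Theta> V \<phi> \<and> fo_over \<Theta> V \<psi>"
| "fo_over \<Theta> V (FEx x \<phi>) \<longleftrightarrow> x \<in> V \<and> fo_over \<Theta> V \<phi>"

primrec free_vars :: "('f, 'v) fo \<Rightarrow> 'v set" where
  "free_vars (FEq t t') = tvars t \<union> tvars t'"
| "free_vars FBot = {}"
| "free_vars FTop = {}"
| "free_vars (FNeg \<phi>) = free_vars \<phi>"
| "free_vars (FAnd \<phi> \<psi>) = free_vars \<phi> \<union> free_vars \<psi>"
| "free_vars (FOr \<phi> \<psi>) = free_vars \<phi> \<union> free_vars \<psi>"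
| "free_vars (FEx x \<phi>) = free_vars \<phi> - {x}"

primrec bound_vars :: "('f, 'v) fo \<Rightarrow> 'v set" where
  "bound_vars (FEq t t') = {}"
| "bound_vars FBot = {}"
| "bound_vars FTop = {}"
| "bound_vars (FNeg \<phi>) = bound_vars \<phi>"
| "bound_vars (FAnd \<phi> \<psi>) = bound_vars \<phi> \<union> bound_vars \<psi>"
| "bound_vars (FOr \<phi> \<psi>) = bound_vars \<phi> \<union> bound_vars \<psi>"
| "bound_vars (FEx x \<phi>) = insert x (bound_vars \<phi>)"

primrec fo_hterm :: "'f variety \<Rightarrow> 'v set \<Rightarrow> ('f, 'v) fo \<Rightarrow> ('f, 'v) hterm" where
  "fo_hterm \<Theta> X0 (FEq t t') = HEq (tcls \<Theta> X0 t) (tcls \<Theta> X0 t')"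
| "fo_hterm \<Theta> X0 FBot = HBot"
| "fo_hterm \<Theta> X0 FTop = HTop"
| "fo_hterm \<Theta> X0 (FNeg \<phi>) = HNeg (fo_hterm \<Theta> X0 \<phi>)"
| "fo_hterm \<Theta> X0 (FAnd \<phi> \<psi>) = HMeet (fo_hterm \<Theta> X0 \<phi>) (fo_hterm \<Theta> X0 \<psi>)"
| "fo_hterm \<Theta> X0 (FOr \<phi> \<psi>) = HJoin (fo_hterm \<Theta> X0 \<phi>) (fo_hterm \<Theta> X0 \<psi>)"
| "fo_hterm \<Theta> X0 (FEx x \<phi>) = HEx x (fo_hterm \<Theta> X0 \<phi>)"

primrec sat :: "('f, 'h) alg \<Rightarrow> ('v \<Rightarrow> 'h) \<Rightarrow> ('f, 'v) fo \<Rightarrow> bool" where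
  "sat H \<rho> (FEq t t') \<longleftrightarrow> evalt (interp H) \<rho> t = evalt (interp H) \<rho> t'"
| "sat H \<rho> FBot \<longleftrightarrow> False"
| "sat H \<rho> FTop \<longleftrightarrow> True"
| "sat H \<rho> (FNeg \<phi>) \<longleftrightarrow> \<not> sat H \<rho> \<phi>"
| "sat H \<rho> (FAnd \<phi> \<psi>) \<longleftrightarrow> sat H \<rho> \<phi> \<and> sat H \<rho> \<psi>"
| "sat H \<rho> (FOr \<phi> \<psi>) \<longleftrightarrow> sat H \<rho> \<phi> \<or> sat H \<rho> \<psi>"
| "sat H \<rho> (FEx x \<phi>) \<longleftrightarrow> (\<exists>a \<in> carr H. sat H (\<rho>(x := a)) \<phi>)"

text \<open>Elements of \<open>\<Phi>(X\<^sup>0)\<close> are classes of formulas, so an element has its free and bound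
  variables as prescribed when it is the class of a first-order formula that does.\<close>

definition special_repr ::
  "'f variety \<Rightarrow> 'v set \<Rightarrow> 'v set \<Rightarrow> ('f, 'v) fo \<Rightarrow> ('f, 'v) hterm set \<Rightarrow> bool" where
  "special_repr \<Theta> X0 X \<phi> u \<longleftrightarrow> fo_over \<Theta> X0 \<phi> \<and> free_vars \<phi> \<subseteq> X \<and> bound_vars \<phi> \<subseteq> X0 - X \<and>
     u = hcls \<Theta> X0 X0 (fo_hterm \<Theta> X0 \<phi>)"

definition special_formula :: "'f variety \<Rightarrow> 'v set \<Rightarrow> 'v set \<Rightarrow> ('f, 'v) hterm set \<Rightarrow> bool" where
  "special_formula \<Theta> X0 X u \<longleftrightarrow> u \<in> hdom (Phi \<Theta> X0) X0 \<and> (\<exists>\<phi>. special_repr \<Theta> X0 X \<phi> u)"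

text \<open>The free variables of a special formula lie in \<open>X\<close>, so the assignment only matters on
  \<open>X\<close>, where it substitutes \<open>\<mu>(x)\<close> for \<open>x\<close>. Representatives of the same class are equivalent in
  \<open>H\<close>, so the choice of \<open>\<phi>\<close> is immaterial.\<close>

definition Tp ::
  "'f variety \<Rightarrow> 'v set \<Rightarrow> ('f, 'h) alg \<Rightarrow> 'v set \<Rightarrow> (('f, 'v) tm set \<Rightarrow> 'h) \<Rightarrow> ('f, 'v) hterm set set" where
  "Tp \<Theta> X0 H X \<mu> = {u. special_formula \<Theta> X0 X u \<and>
     (\<exists>\<phi>. special_repr \<Theta> X0 X \<phi> u \<and> sat H (\<lambda>x \<in> X. \<mu> (gen \<Theta> X x)) \<phi>)}"

definition special_hom ::
  "'f variety \<Rightarrow> 'v set \<Rightarrow> 'v set \<Rightarrow> (('f, 'v) tm set \<Rightarrow> ('f, 'v) tm set) \<Rightarrow> bool" where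
  "special_hom \<Theta> X0 X s \<longleftrightarrow> s \<in> Hom \<Theta> (W \<Theta> X0) (W \<Theta> X) \<and> (\<forall>x \<in> X. s (gen \<Theta> X0 x) = gen \<Theta> X x)"

section \<open>Existence and uniqueness of the homomorphism defining the values of formulas\<close>

text \<open>\<^const>\<open>Hal\<close> and \<^const>\<open>Phi\<close> are Halmos algebras, and every Halmos algebra receives
  exactly one homomorphism from \<^const>\<open>Phi\<close>.\<close>

lemma evalt_cong: "(\<And>x. x \<in> tvars t \<Longrightarrow> \<rho> x = \<rho>' x) \<Longrightarrow> evalt I \<rho> t = evalt I \<rho>' t"
proof (induction t)
  case (Op f ts)
  have "map (evalt I \<rho>) ts = map (evalt I \<rho>') ts"
    using Op by (intro map_cong) auto
  then show ?case by (simp only: evalt.simps)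
qed simp

lemma tvars_Tm: "t \<in> Tm \<Theta> X \<Longrightarrow> tvars t \<subseteq> X"
  by (induction rule: Tm.induct) auto

lemma evalt_subst: "evalt I \<rho> (evalt Op \<sigma> t) = evalt I (\<lambda>n. evalt I \<rho> (\<sigma> n)) t"
proof (induction t)
  case (Op f ts)
  have "map (evalt I \<rho>) (map (evalt Op \<sigma>) ts) = map (evalt I (\<lambda>n. evalt I \<rho> (\<sigma> n))) ts"
    using Op by simp
  then show ?case by (simp only: evalt.simps)
qed simp

lemma subst_Tm: "t \<in> Tm \<Theta> Y \<Longrightarrow> (\<And>y. y \<in> Y \<Longrightarrow> \<sigma> y \<in> Tm \<Theta> X) \<Longrightarrow> evalt Op \<sigma> t \<in> Tm \<Theta> X"
  by (induction rule: Tm.induct) (auto intro!: Tm.Op)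

lemma evalt_closed:
  assumes "in_variety \<Theta> A" "t \<in> Tm \<Theta> X" "\<And>x. x \<in> X \<Longrightarrow> \<rho> x \<in> carr A"
  shows "evalt (interp A) \<rho> t \<in> carr A"
  using assms(2)
proof (induction rule: Tm.induct)
  case (Op f ts)
  have "set (map (evalt (interp A) \<rho>) ts) \<subseteq> carr A" using Op by auto
  then show ?case using Op assms(1) unfolding in_variety_def by simp
qed (use assms in auto)

lemma eqt_Tm:
  assumes "is_variety \<Theta>" "eqt \<Theta> X t u" shows "t \<in> Tm \<Theta> X \<and> u \<in> Tm \<Theta> X"
  using assms(2)
proof (induction rule: eqt.induct)
  case (cong f ts us)
  then show ?case by (auto intro!: Tm.Op simp: list_all2_conv_all_nth in_set_conv_nth)
next
  case (ident l r \<sigma>)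
  then show ?case using assms(1) unfolding is_variety_def by (auto intro!: subst_Tm)
qed auto

lemma eqt_sound:
  assumes "is_variety \<Theta>" "in_variety \<Theta> A" "\<And>x. x \<in> X \<Longrightarrow> \<rho> x \<in> carr A" "eqt \<Theta> X t u"
  shows "evalt (interp A) \<rho> t = evalt (interp A) \<rho> u"
  using assms(4)
proof (induction rule: eqt.induct)
  case (cong f ts us)
  then have "map (evalt (interp A) \<rho>) ts = map (evalt (interp A) \<rho>) us"
    by (auto simp: list_all2_conv_all_nth intro: nth_equalityI)
  then show ?case by (simp only: evalt.simps)
next
  case (ident l r \<sigma>)
  have "range (\<lambda>n. evalt (interp A) \<rho> (\<sigma> n)) \<subseteq> carr A"
    using ident assms evalt_closed by blast
  then show ?case using ident assms(2) unfolding in_variety_def evalt_subst by blast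
qed auto

lemma tcls_eq: "t \<in> Tm \<Theta> X \<Longrightarrow> u \<in> Tm \<Theta> X \<Longrightarrow> tcls \<Theta> X t = tcls \<Theta> X u \<longleftrightarrow> eqt \<Theta> X t u"
  unfolding tcls_def by (auto intro: eqt.intros)

lemma tcls_self: "t \<in> Tm \<Theta> X \<Longrightarrow> t \<in> tcls \<Theta> X t"
  unfolding tcls_def by (auto intro: eqt.intros)

lemma carr_W: "carr (W \<Theta> X) = tcls \<Theta> X ` Tm \<Theta> X" by (simp add: W_def)

lemma gen_W: "x \<in> X \<Longrightarrow> gen \<Theta> X x \<in> carr (W \<Theta> X)" by (simp add: carr_W Tm.Var)

lemma interp_W:
  assumes "is_variety \<Theta>" "f \<in> ops \<Theta>" "length ts = ar \<Theta> f" "set ts \<subseteq> Tm \<Theta> X"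
  shows "interp (W \<Theta> X) f (map (tcls \<Theta> X) ts) = tcls \<Theta> X (Op f ts)"
proof -
  have "list_all2 (\<in>) ts (map (tcls \<Theta> X) ts)"
    using assms(4) by (auto simp: list_all2_conv_all_nth intro!: tcls_self)
  moreover have "eqt \<Theta> X (Op f ts) u" if "list_all2 (\<in>) ts' (map (tcls \<Theta> X) ts)" "eqt \<Theta> X (Op f ts') u" for ts' u
  proof -
    have "list_all2 (eqt \<Theta> X) ts ts'" using that(1) unfolding tcls_def list_all2_conv_all_nth by auto
    then show ?thesis using assms that(2) eqt.cong eqt.trans by metis
  qed
  ultimately show ?thesis unfolding W_def tcls_def by auto
qed

lemma list_reps:
  assumes "set ws \<subseteq> carr (W \<Theta> X)" obtains ts where "ws = map (tcls \<Theta> X) ts" "set ts \<subseteq> Tm \<Theta> X"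
proof -
  have "ws \<in> lists (tcls \<Theta> X ` Tm \<Theta> X)" using assms by (auto simp: carr_W)
  then have "ws \<in> map (tcls \<Theta> X) ` lists (Tm \<Theta> X)" by (simp only: lists_image)
  then show ?thesis using that by auto
qed

lemma W_in_variety:
  assumes v: "is_variety \<Theta>" shows "in_variety \<Theta> (W \<Theta> X)"
proof -
  have cl: "interp (W \<Theta> X) f as \<in> carr (W \<Theta> X)"
    if "f \<in> ops \<Theta>" "length as = ar \<Theta> f" "set as \<subseteq> carr (W \<Theta> X)" for f as
    by (rule list_reps[OF that(3)]) (use that in \<open>auto simp: interp_W[OF v] carr_W intro!: imageI Tm.Op\<close>)
  have ev: "evalt (interp (W \<Theta> X)) \<rho> t = tcls \<Theta> X (evalt Op \<sigma> t)"
    if "t \<in> Tm \<Theta> UNIV" "\<And>n::nat. \<sigma> n \<in> Tm \<Theta> X" "\<And>n. \<rho> n = tcls \<Theta> X (\<sigma> n)" for \<rho> \<sigma> t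
    using that(1)
  proof (induction rule: Tm.induct)
    case (Op f ts)
    have e: "map (evalt (interp (W \<Theta> X)) \<rho>) ts = map (tcls \<Theta> X) (map (evalt Op \<sigma>) ts)"
      using Op by simp
    have s: "set (map (evalt Op \<sigma>) ts) \<subseteq> Tm \<Theta> X" using Op that(2) by (auto intro!: subst_Tm)
    show ?case using interp_W[OF v Op(1) _ s] Op(2) by (simp only: evalt.simps e length_map)
  qed (use that in auto)
  have "evalt (interp (W \<Theta> X)) \<rho> l = evalt (interp (W \<Theta> X)) \<rho> r"
    if lr: "(l, r) \<in> idents \<Theta>" and "range \<rho> \<subseteq> carr (W \<Theta> X)" for l r \<rho>
  proof -
    have "\<forall>n. \<exists>t \<in> Tm \<Theta> X. \<rho> n = tcls \<Theta> X t" using that by (auto simp: carr_W)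
    then obtain \<sigma> where s: "\<And>n. \<sigma> n \<in> Tm \<Theta> X" "\<And>n. \<rho> n = tcls \<Theta> X (\<sigma> n)" by metis
    have "l \<in> Tm \<Theta> UNIV" "r \<in> Tm \<Theta> UNIV" using v lr unfolding is_variety_def by auto
    moreover have "eqt \<Theta> X (evalt Op \<sigma> l) (evalt Op \<sigma> r)" using eqt.ident[OF lr] s by blast
    ultimately show ?thesis using ev s v tcls_eq eqt_Tm by metis
  qed
  then show ?thesis using cl unfolding in_variety_def by blast
qed

lemma Hom_op: "h \<in> Hom \<Theta> A B \<Longrightarrow> f \<in> ops \<Theta> \<Longrightarrow> length as = ar \<Theta> f \<Longrightarrow> set as \<subseteq> carr A \<Longrightarrow>
    h (interp A f as) = interp B f (map h as)"
  by (simp add: Hom_def)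

lemma Hom_eval:
  assumes v: "is_variety \<Theta>" and h: "h \<in> Hom \<Theta> (W \<Theta> X) A" and "t \<in> Tm \<Theta> X"
  shows "h (tcls \<Theta> X t) = evalt (interp A) (\<lambda>x. h (gen \<Theta> X x)) t"
  using assms(3)
proof (induction rule: Tm.induct)
  case (Op f ts)
  have s: "set ts \<subseteq> Tm \<Theta> X" using Op by auto
  have "h (tcls \<Theta> X (Op f ts)) = h (interp (W \<Theta> X) f (map (tcls \<Theta> X) ts))"
    using interp_W[OF v Op(1,2) s] by simp
  also have "\<dots> = interp A f (map h (map (tcls \<Theta> X) ts))"
    by (rule Hom_op[OF h Op(1)]) (use Op(2) s in \<open>auto simp: carr_W\<close>)
  also have "map h (map (tcls \<Theta> X) ts) = map (evalt (interp A) (\<lambda>x. h (gen \<Theta> X x))) ts"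
    using Op by simp
  finally show ?case by (simp only: evalt.simps)
qed simp

lemma Hom_ext:
  assumes "is_variety \<Theta>" "h \<in> Hom \<Theta> (W \<Theta> X) A" "h' \<in> Hom \<Theta> (W \<Theta> X) A"
    "\<And>x. x \<in> X \<Longrightarrow> h (gen \<Theta> X x) = h' (gen \<Theta> X x)"
  shows "h = h'"
proof (rule extensionalityI[where A = "carr (W \<Theta> X)"])
  fix w assume "w \<in> carr (W \<Theta> X)"
  then obtain t where t: "t \<in> Tm \<Theta> X" "w = tcls \<Theta> X t" by (auto simp: carr_W)
  have "evalt (interp A) (\<lambda>x. h (gen \<Theta> X x)) t = evalt (interp A) (\<lambda>x. h' (gen \<Theta> X x)) t"
    by (rule evalt_cong) (use tvars_Tm[OF t(1)] assms(4) in auto)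
  then show "h w = h' w" using Hom_eval assms t by metis
qed (use assms in \<open>auto simp: Hom_def PiE_def\<close>)

lemma Hom_carr: "h \<in> Hom \<Theta> A B \<Longrightarrow> a \<in> carr A \<Longrightarrow> h a \<in> carr B" by (auto simp: Hom_def)

text \<open>\<open>W(X)\<close> is free in the variety.\<close>

lemma Hom_extend:
  assumes v: "is_variety \<Theta>" and A: "in_variety \<Theta> A" and \<rho>: "\<And>x. x \<in> X \<Longrightarrow> \<rho> x \<in> carr A"
  obtains h where "h \<in> Hom \<Theta> (W \<Theta> X) A" "\<And>x. x \<in> X \<Longrightarrow> h (gen \<Theta> X x) = \<rho> x"
proof -
  define rep where "rep w = (SOME t. t \<in> Tm \<Theta> X \<and> tcls \<Theta> X t = w)" for w
  define h where "h = (\<lambda>w \<in> carr (W \<Theta> X). evalt (interp A) \<rho> (rep w))"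
  have h: "h (tcls \<Theta> X t) = evalt (interp A) \<rho> t" if t: "t \<in> Tm \<Theta> X" for t
  proof -
    have "rep (tcls \<Theta> X t) \<in> Tm \<Theta> X \<and> tcls \<Theta> X (rep (tcls \<Theta> X t)) = tcls \<Theta> X t"
      unfolding rep_def by (rule someI) (use t in simp)
    then have "eqt \<Theta> X (rep (tcls \<Theta> X t)) t" using tcls_eq t by blast
    then show ?thesis using eqt_sound[OF v A \<rho>] t by (auto simp: h_def carr_W)
  qed
  have "h \<in> Hom \<Theta> (W \<Theta> X) A"
    unfolding Hom_def
  proof (intro CollectI conjI ballI allI impI PiE_I)
    fix w assume "w \<in> carr (W \<Theta> X)" then show "h w \<in> carr A"
      using evalt_closed[OF A _ \<rho>] h by (auto simp: carr_W)
  next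
    fix f as assume f: "f \<in> ops \<Theta>" and as: "length as = ar \<Theta> f \<and> set as \<subseteq> carr (W \<Theta> X)"
    obtain ts where ts: "as = map (tcls \<Theta> X) ts" "set ts \<subseteq> Tm \<Theta> X" using list_reps as by blast
    have "Op f ts \<in> Tm \<Theta> X" using f as ts by (auto intro!: Tm.Op)
    moreover have "map h as = map (evalt (interp A) \<rho>) ts" using ts h by auto
    ultimately show "h (interp (W \<Theta> X) f as) = interp A f (map h as)"
      using interp_W[OF v f _ ts(2)] ts(1) as h by (metis evalt.simps(2) length_map)
  qed (simp add: h_def)
  moreover have "h (gen \<Theta> X x) = \<rho> x" if "x \<in> X" for x using h[OF Tm.Var] that by simp
  ultimately show ?thesis using that by blast
qed

lemma Hom_compose:
  assumes "is_variety \<Theta>" "s \<in> Hom \<Theta> (W \<Theta> X) (W \<Theta> Y)" "\<mu> \<in> Hom \<Theta> (W \<Theta> Y) A"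
  shows "compose (carr (W \<Theta> X)) \<mu> s \<in> Hom \<Theta> (W \<Theta> X) A"
proof -
  have "\<mu> (s (interp (W \<Theta> X) f as)) = interp A f (map (compose (carr (W \<Theta> X)) \<mu> s) as) \<and> interp (W \<Theta> X) f as \<in> carr (W \<Theta> X)"
    if f: "f \<in> ops \<Theta>" and as: "length as = ar \<Theta> f" "set as \<subseteq> carr (W \<Theta> X)" for f as
  proof -
    have "s (interp (W \<Theta> X) f as) = interp (W \<Theta> Y) f (map s as)"
      using assms(2) that unfolding Hom_def by simp
    moreover have "set (map s as) \<subseteq> carr (W \<Theta> Y)" using as Hom_carr[OF assms(2)] by auto
    then have "\<mu> (interp (W \<Theta> Y) f (map s as)) = interp A f (map \<mu> (map s as))"
      using assms(3) that unfolding Hom_def by simp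
    moreover have "map \<mu> (map s as) = map (compose (carr (W \<Theta> X)) \<mu> s) as"
      using as by (auto simp: compose_def)
    moreover have "interp (W \<Theta> X) f as \<in> carr (W \<Theta> X)"
      using W_in_variety[OF assms(1)] that unfolding in_variety_def by blast
    ultimately show ?thesis by metis
  qed
  then show ?thesis
    using Hom_carr[OF assms(2)] Hom_carr[OF assms(3)] unfolding Hom_def by (auto simp: compose_def)
qed

lemma Hal_simps [simp]:
  "hdom (Hal \<Theta> H) X = Pow (Hom \<Theta> (W \<Theta> X) H)"
  "hbot (Hal \<Theta> H) X = {}"
  "htop (Hal \<Theta> H) X = Hom \<Theta> (W \<Theta> X) H"
  "hneg (Hal \<Theta> H) X A = Hom \<Theta> (W \<Theta> X) H - A"
  "hmeet (Hal \<Theta> H) X A B = A \<inter> B"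
  "hjoin (Hal \<Theta> H) X A B = A \<union> B"
  "hex (Hal \<Theta> H) X x A = {\<mu> \<in> Hom \<Theta> (W \<Theta> X) H. \<exists>\<nu> \<in> A. agree_off \<Theta> X x \<mu> \<nu>}"
  "heq (Hal \<Theta> H) X w w' = {\<mu> \<in> Hom \<Theta> (W \<Theta> X) H. \<mu> w = \<mu> w'}"
  "hsub (Hal \<Theta> H) X Y s A = {\<mu> \<in> Hom \<Theta> (W \<Theta> Y) H. compose (carr (W \<Theta> X)) \<mu> s \<in> A}"
  by (simp_all add: Hal_def)

lemma agree_off_comm:
  assumes v: "is_variety \<Theta>" and H: "in_variety \<Theta> H"
    and \<mu>: "\<mu> \<in> Hom \<Theta> (W \<Theta> X) H" and \<nu>: "\<nu> \<in> Hom \<Theta> (W \<Theta> X) H"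
    and k: "\<kappa> \<in> Hom \<Theta> (W \<Theta> X) H" and a: "agree_off \<Theta> X x \<mu> \<nu>" "agree_off \<Theta> X y \<nu> \<kappa>"
  shows "\<exists>\<nu>' \<in> Hom \<Theta> (W \<Theta> X) H. agree_off \<Theta> X y \<mu> \<nu>' \<and> agree_off \<Theta> X x \<nu>' \<kappa>"
proof (cases "x = y")
  case True
  then show ?thesis using \<nu> a by auto
next
  case False
  define \<rho> where "\<rho> z = (if z = y then \<kappa> (gen \<Theta> X z) else \<mu> (gen \<Theta> X z))" for z
  obtain h where "h \<in> Hom \<Theta> (W \<Theta> X) H" "\<And>z. z \<in> X \<Longrightarrow> h (gen \<Theta> X z) = \<rho> z"
    by (rule Hom_extend[OF v H, of X \<rho>]) (auto simp: \<rho>_def intro!: Hom_carr[OF \<mu>] Hom_carr[OF k] gen_W)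
  then show ?thesis using a False by (intro bexI[of _ h]) (auto simp: agree_off_def \<rho>_def)
qed

lemma Hal_sort:
  assumes v: "is_variety \<Theta>" and H: "in_variety \<Theta> H"
  shows "extended_boolean_sort \<Theta> (Hal \<Theta> H) X"
proof -
  have op: "foldr (\<inter>) (map2 (heq (Hal \<Theta> H) X) ws ws') (Hom \<Theta> (W \<Theta> X) H)
      = {\<mu> \<in> Hom \<Theta> (W \<Theta> X) H. map \<mu> ws = map \<mu> ws'}" if "length ws = length ws'" for ws ws'
    using that by (induction ws ws' rule: list_induct2) auto
  have hm: "hmeet (Hal \<Theta> H) X = (\<inter>)" by (simp add: fun_eq_iff)
  have bs: "boolean_sort (Hal \<Theta> H) X" by (auto simp: boolean_sort_def)
  have refl: "agree_off \<Theta> X x \<mu> \<mu>" for x and \<mu> :: "('a, 'c) tm set \<Rightarrow> 'b" by (simp add: agree_off_def)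
  have tr: "agree_off \<Theta> X x \<mu> \<nu> \<Longrightarrow> agree_off \<Theta> X x \<nu> \<kappa> \<Longrightarrow> agree_off \<Theta> X x \<mu> \<kappa>"
    for x and \<mu> \<nu> \<kappa> :: "('a, 'c) tm set \<Rightarrow> 'b" by (simp add: agree_off_def)
  have sy: "agree_off \<Theta> X x \<mu> \<nu> \<Longrightarrow> agree_off \<Theta> X x \<nu> \<mu>"
    for x and \<mu> \<nu> :: "('a, 'c) tm set \<Rightarrow> 'b" by (simp add: agree_off_def)
  have cm: "hex (Hal \<Theta> H) X x (hex (Hal \<Theta> H) X y A) \<subseteq> hex (Hal \<Theta> H) X y (hex (Hal \<Theta> H) X x A)"
    if "A \<subseteq> Hom \<Theta> (W \<Theta> X) H" for x y A
  proof
    fix \<mu> assume "\<mu> \<in> hex (Hal \<Theta> H) X x (hex (Hal \<Theta> H) X y A)"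
    then obtain \<nu> \<kappa> where "\<mu> \<in> Hom \<Theta> (W \<Theta> X) H" "\<nu> \<in> Hom \<Theta> (W \<Theta> X) H" "\<kappa> \<in> A"
      "agree_off \<Theta> X x \<mu> \<nu>" "agree_off \<Theta> X y \<nu> \<kappa>" by auto
    then show "\<mu> \<in> hex (Hal \<Theta> H) X y (hex (Hal \<Theta> H) X x A)"
      using agree_off_comm[OF v H, of \<mu> X \<nu> \<kappa> x y] that by auto
  qed
  show ?thesis
    unfolding extended_boolean_sort_def Let_def
  proof (intro conjI ballI allI impI bs)
    fix x a assume "x \<in> X" "a \<in> hdom (Hal \<Theta> H) X"
    then show "hmeet (Hal \<Theta> H) X a (hex (Hal \<Theta> H) X x a) = a" using refl by auto
  next
    fix x a b assume ab: "a \<in> hdom (Hal \<Theta> H) X" "b \<in> hdom (Hal \<Theta> H) X"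
    show "hex (Hal \<Theta> H) X x (hmeet (Hal \<Theta> H) X a (hex (Hal \<Theta> H) X x b)) =
       hmeet (Hal \<Theta> H) X (hex (Hal \<Theta> H) X x a) (hex (Hal \<Theta> H) X x b)"
    proof (intro set_eqI iffI)
      fix \<mu> assume "\<mu> \<in> hex (Hal \<Theta> H) X x (hmeet (Hal \<Theta> H) X a (hex (Hal \<Theta> H) X x b))"
      then obtain \<nu> \<kappa> where h: "\<mu> \<in> Hom \<Theta> (W \<Theta> X) H" "\<nu> \<in> a" "\<kappa> \<in> b"
        and "agree_off \<Theta> X x \<mu> \<nu>" "agree_off \<Theta> X x \<nu> \<kappa>" by auto
      moreover from this have "agree_off \<Theta> X x \<mu> \<kappa>" using tr by blast
      ultimately show "\<mu> \<in> hmeet (Hal \<Theta> H) X (hex (Hal \<Theta> H) X x a) (hex (Hal \<Theta> H) X x b)" by auto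
    next
      fix \<mu> assume "\<mu> \<in> hmeet (Hal \<Theta> H) X (hex (Hal \<Theta> H) X x a) (hex (Hal \<Theta> H) X x b)"
      then obtain \<nu> \<kappa> where h: "\<mu> \<in> Hom \<Theta> (W \<Theta> X) H" "\<nu> \<in> a" "\<kappa> \<in> b"
        and "agree_off \<Theta> X x \<mu> \<nu>" "agree_off \<Theta> X x \<mu> \<kappa>" by auto
      moreover from this have "agree_off \<Theta> X x \<nu> \<kappa>" using tr sy by blast
      ultimately show "\<mu> \<in> hex (Hal \<Theta> H) X x (hmeet (Hal \<Theta> H) X a (hex (Hal \<Theta> H) X x b))"
        using ab by auto
    qed
  next
    fix x y a assume "x \<in> X" "y \<in> X" "a \<in> hdom (Hal \<Theta> H) X"
    then show "hex (Hal \<Theta> H) X x (hex (Hal \<Theta> H) X y a) = hex (Hal \<Theta> H) X y (hex (Hal \<Theta> H) X x a)"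
      using cm[of a x y] cm[of a y x] by (simp only: Hal_simps Pow_iff) blast
  next
    fix f ws ws' assume f: "f \<in> ops \<Theta>" and a: "length ws = ar \<Theta> f \<and> length ws' = ar \<Theta> f \<and>
        set ws \<subseteq> carr (W \<Theta> X) \<and> set ws' \<subseteq> carr (W \<Theta> X)"
    have "\<mu> (interp (W \<Theta> X) f ws) = \<mu> (interp (W \<Theta> X) f ws')"
      if "\<mu> \<in> Hom \<Theta> (W \<Theta> X) H" "map \<mu> ws = map \<mu> ws'" for \<mu>
    proof -
      have "\<mu> (interp (W \<Theta> X) f ws) = interp H f (map \<mu> ws)"
        "\<mu> (interp (W \<Theta> X) f ws') = interp H f (map \<mu> ws')"
        using that(1) f a unfolding Hom_def by blast+
      then show ?thesis using that by simp
    qed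
    moreover have "foldr (hmeet (Hal \<Theta> H) X) (map2 (heq (Hal \<Theta> H) X) ws ws') (htop (Hal \<Theta> H) X) =
        {\<mu> \<in> Hom \<Theta> (W \<Theta> X) H. map \<mu> ws = map \<mu> ws'}"
      unfolding hm Hal_simps(3) by (rule op) (use a in simp)
    ultimately show "hmeet (Hal \<Theta> H) X (foldr (hmeet (Hal \<Theta> H) X) (map2 (heq (Hal \<Theta> H) X) ws ws') (htop (Hal \<Theta> H) X))
          (heq (Hal \<Theta> H) X (interp (W \<Theta> X) f ws) (interp (W \<Theta> X) f ws')) =
         foldr (hmeet (Hal \<Theta> H) X) (map2 (heq (Hal \<Theta> H) X) ws ws') (htop (Hal \<Theta> H) X)"
      unfolding hm Hal_simps(8) by blast
  qed auto
qed

lemma compose_gen: "x \<in> X \<Longrightarrow> compose (carr (W \<Theta> X)) \<mu> s (gen \<Theta> X x) = \<mu> (s (gen \<Theta> X x))"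
  by (simp add: compose_def gen_W)

lemma Hal_fresh:
  assumes v: "is_variety \<Theta>" and H: "in_variety \<Theta> H"
    and s: "s \<in> Hom \<Theta> (W \<Theta> X) (W \<Theta> Y)" and f: "fresh_subst \<Theta> X Y s x y"
    and A: "A \<subseteq> Hom \<Theta> (W \<Theta> X) H"
  shows "hsub (Hal \<Theta> H) X Y s (hex (Hal \<Theta> H) X x A) = hex (Hal \<Theta> H) Y y (hsub (Hal \<Theta> H) X Y s A)"
proof -
  have xy: "x \<in> X" "y \<in> Y" "s (gen \<Theta> X x) = gen \<Theta> Y y" using f by (auto simp: fresh_subst_def)
  have eq: "\<mu> (s (gen \<Theta> X x')) = \<mu>' (s (gen \<Theta> X x'))"
    if "\<mu> \<in> Hom \<Theta> (W \<Theta> Y) H" "\<mu>' \<in> Hom \<Theta> (W \<Theta> Y) H" "agree_off \<Theta> Y y \<mu> \<mu>'" "x' \<in> X - {x}" for \<mu> \<mu>' x'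
  proof -
    obtain t where t: "t \<in> s (gen \<Theta> X x')" "y \<notin> tvars t" using f \<open>x' \<in> X - {x}\<close> unfolding fresh_subst_def by blast
    have "s (gen \<Theta> X x') \<in> carr (W \<Theta> Y)" 
      by (rule Hom_carr[OF s gen_W]) (use \<open>x' \<in> X - {x}\<close> in simp)
    then obtain t' where "s (gen \<Theta> X x') = tcls \<Theta> Y t'" "t' \<in> Tm \<Theta> Y" by (auto simp: carr_W)
    moreover from this have "eqt \<Theta> Y t' t" using t(1) by (simp add: tcls_def)
    ultimately have t': "t \<in> Tm \<Theta> Y" "s (gen \<Theta> X x') = tcls \<Theta> Y t"
      using eqt_Tm[OF v] tcls_eq by metis+
    have "evalt (interp H) (\<lambda>x. \<mu> (gen \<Theta> Y x)) t = evalt (interp H) (\<lambda>x. \<mu>' (gen \<Theta> Y x)) t"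
      by (rule evalt_cong) (use tvars_Tm[OF t'(1)] t(2) that(3) in \<open>auto simp: agree_off_def\<close>)
    then show ?thesis using Hom_eval[OF v] that t' by metis
  qed
  show ?thesis
  proof (intro set_eqI iffI)
    fix \<mu> assume "\<mu> \<in> hsub (Hal \<Theta> H) X Y s (hex (Hal \<Theta> H) X x A)"
    then obtain \<nu> where m: "\<mu> \<in> Hom \<Theta> (W \<Theta> Y) H" "\<nu> \<in> A"
      "agree_off \<Theta> X x (compose (carr (W \<Theta> X)) \<mu> s) \<nu>" by auto
    have n: "\<nu> \<in> Hom \<Theta> (W \<Theta> X) H" using m A by auto
    define \<rho> where "\<rho> z = (if z = y then \<nu> (gen \<Theta> X x) else \<mu> (gen \<Theta> Y z))" for z
    obtain h where h: "h \<in> Hom \<Theta> (W \<Theta> Y) H" "\<And>z. z \<in> Y \<Longrightarrow> h (gen \<Theta> Y z) = \<rho> z"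
      by (rule Hom_extend[OF v H, of Y \<rho>])
        (use xy in \<open>auto simp: \<rho>_def intro!: Hom_carr[OF m(1)] Hom_carr[OF n] gen_W\<close>)
    have ag: "agree_off \<Theta> Y y \<mu> h" using h by (auto simp: agree_off_def \<rho>_def)
    have "compose (carr (W \<Theta> X)) h s = \<nu>"
    proof (rule Hom_ext[OF v Hom_compose[OF v s h(1)] n])
      fix z assume z: "z \<in> X"
      show "compose (carr (W \<Theta> X)) h s (gen \<Theta> X z) = \<nu> (gen \<Theta> X z)"
        using z xy h(2)[OF xy(2)] eq[OF m(1) h(1) ag, of z] m(3)
        by (cases "z = x") (auto simp: compose_gen \<rho>_def agree_off_def)
    qed
    then show "\<mu> \<in> hex (Hal \<Theta> H) Y y (hsub (Hal \<Theta> H) X Y s A)" using m h(1) ag by auto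
  next
    fix \<mu> assume "\<mu> \<in> hex (Hal \<Theta> H) Y y (hsub (Hal \<Theta> H) X Y s A)"
    then obtain \<mu>' where m: "\<mu> \<in> Hom \<Theta> (W \<Theta> Y) H" "\<mu>' \<in> Hom \<Theta> (W \<Theta> Y) H"
      "agree_off \<Theta> Y y \<mu> \<mu>'" "compose (carr (W \<Theta> X)) \<mu>' s \<in> A" by auto
    have "agree_off \<Theta> X x (compose (carr (W \<Theta> X)) \<mu> s) (compose (carr (W \<Theta> X)) \<mu>' s)"
      using eq[OF m(1-3)] by (auto simp: agree_off_def compose_gen)
    then show "\<mu> \<in> hsub (Hal \<Theta> H) X Y s (hex (Hal \<Theta> H) X x A)" using m Hom_compose[OF v s] by auto
  qed
qed

theorem Hal_halmos:
  fixes X0 :: "'v set" and H :: "('f, 'h) alg"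
  assumes v: "is_variety \<Theta>" and H: "in_variety \<Theta> H"
  shows "halmos_algebra \<Theta> X0 (Hal \<Theta> H)"
  unfolding halmos_algebra_def Let_def
proof (intro conjI ballI allI impI Hal_sort[OF v H])
  fix X Y :: "'v set" and s assume "s \<in> Hom \<Theta> (W \<Theta> X) (W \<Theta> Y)"
  then show "boolean_hom_between (Hal \<Theta> H) X (Hal \<Theta> H) Y (hsub (Hal \<Theta> H) X Y s)"
    using Hom_compose[OF v] by (auto simp: boolean_hom_between_def)
next
  fix X :: "'v set" and a assume "a \<in> hdom (Hal \<Theta> H) X"
  moreover have "compose (carr (W \<Theta> X)) \<mu> (\<lambda>w \<in> carr (W \<Theta> X). w) = \<mu>" if "\<mu> \<in> Hom \<Theta> (W \<Theta> X) H" for \<mu>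
    using that by (auto simp: Hom_def compose_def PiE_def extensional_def)
  ultimately show "hsub (Hal \<Theta> H) X X (\<lambda>w \<in> carr (W \<Theta> X). w) a = a" by auto
next
  fix X Y Z :: "'v set" and s s' a assume s: "s \<in> Hom \<Theta> (W \<Theta> X) (W \<Theta> Y)" "s' \<in> Hom \<Theta> (W \<Theta> Y) (W \<Theta> Z)"
  have "compose (carr (W \<Theta> X)) (compose (carr (W \<Theta> Y)) \<mu> s') s =
      compose (carr (W \<Theta> X)) \<mu> (compose (carr (W \<Theta> X)) s' s)" for \<mu> :: "_ \<Rightarrow> 'h"
    using Hom_carr[OF s(1)] by (auto simp: compose_def)
  then show "hsub (Hal \<Theta> H) X Z (compose (carr (W \<Theta> X)) s' s) a = hsub (Hal \<Theta> H) Y Z s' (hsub (Hal \<Theta> H) X Y s a)"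
    using Hom_compose[OF v s(2)] by auto
next
  fix X Y :: "'v set" and s s' x a
  assume s: "s \<in> Hom \<Theta> (W \<Theta> X) (W \<Theta> Y)" "s' \<in> Hom \<Theta> (W \<Theta> X) (W \<Theta> Y)" and a: "agree_off \<Theta> X x s s'"
  have "agree_off \<Theta> X x (compose (carr (W \<Theta> X)) \<mu> s) \<nu> \<longleftrightarrow> agree_off \<Theta> X x (compose (carr (W \<Theta> X)) \<mu> s') \<nu>"
    for \<mu> \<nu> :: "_ \<Rightarrow> 'h" using a by (auto simp: agree_off_def compose_gen)
  then show "hsub (Hal \<Theta> H) X Y s (hex (Hal \<Theta> H) X x a) = hsub (Hal \<Theta> H) X Y s' (hex (Hal \<Theta> H) X x a)"
    using Hom_compose[OF v s(1)] Hom_compose[OF v s(2)] by auto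
next
  fix X Y :: "'v set" and s x y a assume "s \<in> Hom \<Theta> (W \<Theta> X) (W \<Theta> Y)" "a \<in> hdom (Hal \<Theta> H) X" "fresh_subst \<Theta> X Y s x y"
  then show "hsub (Hal \<Theta> H) X Y s (hex (Hal \<Theta> H) X x a) = hex (Hal \<Theta> H) Y y (hsub (Hal \<Theta> H) X Y s a)"
    using Hal_fresh[OF v H] by simp
next
  fix X Y :: "'v set" and s w w' assume "s \<in> Hom \<Theta> (W \<Theta> X) (W \<Theta> Y)" "w \<in> carr (W \<Theta> X)" "w' \<in> carr (W \<Theta> X)"
  then show "hsub (Hal \<Theta> H) X Y s (heq (Hal \<Theta> H) X w w') = heq (Hal \<Theta> H) Y (s w) (s w')"
    using Hom_compose[OF v] by (auto simp: compose_def)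
next
  fix X :: "'v set" and x w w' s s' a assume x: "x \<in> X" and o: "one_subst \<Theta> X x w s \<and> one_subst \<Theta> X x w' s'"
  then have s: "s \<in> Hom \<Theta> (W \<Theta> X) (W \<Theta> X)" "s' \<in> Hom \<Theta> (W \<Theta> X) (W \<Theta> X)" by (auto simp: one_subst_def)
  have "compose (carr (W \<Theta> X)) \<mu> s = compose (carr (W \<Theta> X)) \<mu> s'"
    if "\<mu> \<in> Hom \<Theta> (W \<Theta> X) H" "\<mu> w = \<mu> w'" for \<mu>
  proof (rule Hom_ext[OF v Hom_compose[OF v s(1) that(1)] Hom_compose[OF v s(2) that(1)]])
    fix z assume "z \<in> X"
    then show "compose (carr (W \<Theta> X)) \<mu> s (gen \<Theta> X z) = compose (carr (W \<Theta> X)) \<mu> s' (gen \<Theta> X z)"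
      using o that by (cases "z = x") (auto simp: compose_gen one_subst_def)
  qed
  then show "hmeet (Hal \<Theta> H) X (hmeet (Hal \<Theta> H) X (hsub (Hal \<Theta> H) X X s a) (heq (Hal \<Theta> H) X w w'))
         (hsub (Hal \<Theta> H) X X s' a) = hmeet (Hal \<Theta> H) X (hsub (Hal \<Theta> H) X X s a) (heq (Hal \<Theta> H) X w w')"
    by auto
qed

lemma hcong_sorts: "hcong \<Theta> X0 X p q \<Longrightarrow> of_sort \<Theta> X0 p X \<and> of_sort \<Theta> X0 q X \<and> X \<in> Gams X0"
  by (induction rule: hcong.induct) auto

lemma hcls_eq: "of_sort \<Theta> X0 p X \<Longrightarrow> of_sort \<Theta> X0 q X \<Longrightarrow> X \<in> Gams X0 \<Longrightarrow>
    hcls \<Theta> X0 X p = hcls \<Theta> X0 X q \<longleftrightarrow> hcong \<Theta> X0 X p q"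
  unfolding hcls_def by (auto intro: hcong.intros)

lemma hcls_eqI: "hcong \<Theta> X0 X p q \<Longrightarrow> hcls \<Theta> X0 X p = hcls \<Theta> X0 X q"
  unfolding hcls_def by (auto intro: hcong.intros)

lemma hcls_ax: "hax \<Theta> X p q \<Longrightarrow> of_sort \<Theta> X0 p X \<Longrightarrow> of_sort \<Theta> X0 q X \<Longrightarrow> X \<in> Gams X0 \<Longrightarrow>
    hcls \<Theta> X0 X p = hcls \<Theta> X0 X q"
  by (intro hcls_eqI hcong.ax)

lemma UN_class:
  assumes "\<And>q. q \<in> S \<Longrightarrow> F q = A" "S \<noteq> {}" shows "(\<Union>q \<in> S. F q) = A"
  using assms by auto

lemma hcls_ne: "of_sort \<Theta> X0 p X \<Longrightarrow> X \<in> Gams X0 \<Longrightarrow> p \<in> hcls \<Theta> X0 X p"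
  by (simp add: hcls_def hcong.refl)

lemma Phi_simps:
  "hdom (Phi \<Theta> X0) X = hcls \<Theta> X0 X ` {p. of_sort \<Theta> X0 p X}"
  "hbot (Phi \<Theta> X0) X = hcls \<Theta> X0 X HBot"
  "htop (Phi \<Theta> X0) X = hcls \<Theta> X0 X HTop"
  "heq (Phi \<Theta> X0) X w w' = hcls \<Theta> X0 X (HEq w w')"
  by (simp_all add: Phi_def)

lemma Phi_ops:
  assumes X: "X \<in> Gams X0" and p: "of_sort \<Theta> X0 p X"
  shows "hneg (Phi \<Theta> X0) X (hcls \<Theta> X0 X p) = hcls \<Theta> X0 X (HNeg p)"
    "of_sort \<Theta> X0 q X \<Longrightarrow> hmeet (Phi \<Theta> X0) X (hcls \<Theta> X0 X p) (hcls \<Theta> X0 X q) = hcls \<Theta> X0 X (HMeet p q)"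
    "of_sort \<Theta> X0 q X \<Longrightarrow> hjoin (Phi \<Theta> X0) X (hcls \<Theta> X0 X p) (hcls \<Theta> X0 X q) = hcls \<Theta> X0 X (HJoin p q)"
    "x \<in> X \<Longrightarrow> hex (Phi \<Theta> X0) X x (hcls \<Theta> X0 X p) = hcls \<Theta> X0 X (HEx x p)"
    "Y \<in> Gams X0 \<Longrightarrow> s \<in> Hom \<Theta> (W \<Theta> X) (W \<Theta> Y) \<Longrightarrow>
      hsub (Phi \<Theta> X0) X Y s (hcls \<Theta> X0 X p) = hcls \<Theta> X0 Y (HSub X s p)"
proof -
  have p': "hcls \<Theta> X0 X p \<noteq> {}" and c: "\<And>p p'. p' \<in> hcls \<Theta> X0 X p \<Longrightarrow> hcong \<Theta> X0 X p' p"
    using hcls_ne[OF p X] by (auto simp: hcls_def intro: hcong.sym)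
  show "hneg (Phi \<Theta> X0) X (hcls \<Theta> X0 X p) = hcls \<Theta> X0 X (HNeg p)"
    unfolding Phi_def by (simp del: UN_simps, intro UN_class p' hcls_eqI hcong.neg c; assumption)
  show "hex (Phi \<Theta> X0) X x (hcls \<Theta> X0 X p) = hcls \<Theta> X0 X (HEx x p)" if x: "x \<in> X"
    unfolding Phi_def by (simp del: UN_simps, intro UN_class p' hcls_eqI hcong.ex[OF _ x] c; assumption)
  show "hsub (Phi \<Theta> X0) X Y s (hcls \<Theta> X0 X p) = hcls \<Theta> X0 Y (HSub X s p)"
    if s: "Y \<in> Gams X0" "s \<in> Hom \<Theta> (W \<Theta> X) (W \<Theta> Y)"
    unfolding Phi_def by (simp del: UN_simps, intro UN_class p' hcls_eqI hcong.sub[OF _ s] c; assumption)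
  assume q: "of_sort \<Theta> X0 q X"
  then have q': "hcls \<Theta> X0 X q \<noteq> {}" using hcls_ne[OF q X] by auto
  show "hmeet (Phi \<Theta> X0) X (hcls \<Theta> X0 X p) (hcls \<Theta> X0 X q) = hcls \<Theta> X0 X (HMeet p q)"
    unfolding Phi_def by (simp del: UN_simps, intro UN_class p' q' hcls_eqI hcong.meet c; assumption)
  show "hjoin (Phi \<Theta> X0) X (hcls \<Theta> X0 X p) (hcls \<Theta> X0 X q) = hcls \<Theta> X0 X (HJoin p q)"
    unfolding Phi_def by (simp del: UN_simps, intro UN_class p' q' hcls_eqI hcong.join c; assumption)
qed

lemma foldr_Phi:
  assumes X: "X \<in> Gams X0" and "length ws = length ws'" "set ws \<subseteq> carr (W \<Theta> X)" "set ws' \<subseteq> carr (W \<Theta> X)"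
  shows "of_sort \<Theta> X0 (foldr HMeet (map2 HEq ws ws') HTop) X \<and>
    foldr (hmeet (Phi \<Theta> X0) X) (map2 (heq (Phi \<Theta> X0) X) ws ws') (htop (Phi \<Theta> X0) X) =
    hcls \<Theta> X0 X (foldr HMeet (map2 HEq ws ws') HTop)"
  using assms(2-) by (induction ws ws' rule: list_induct2) (auto simp: Phi_simps Phi_ops[OF X])

theorem Phi_halmos:
  assumes v: "is_variety \<Theta>"
  shows "halmos_algebra \<Theta> X0 (Phi \<Theta> X0)"
proof -
  have W: "interp (W \<Theta> X) f ws \<in> carr (W \<Theta> X)"
    if "f \<in> ops \<Theta>" "length ws = ar \<Theta> f" "set ws \<subseteq> carr (W \<Theta> X)" for f ws and X :: "'b set"
    using W_in_variety[OF v] that unfolding in_variety_def by blast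
  have bs: "boolean_sort (Phi \<Theta> X0) X" if X: "X \<in> Gams X0" for X
    unfolding boolean_sort_def
    by (auto simp: Phi_simps Phi_ops[OF X] hcls_eq X intro!: hcong.ax intro: hax.intros)
  have es: "extended_boolean_sort \<Theta> (Phi \<Theta> X0) X" if X: "X \<in> Gams X0" for X
    unfolding extended_boolean_sort_def Let_def
  proof (intro conjI ballI allI impI bs[OF X])
    fix f ws ws' assume f: "f \<in> ops \<Theta>" and a: "length ws = ar \<Theta> f \<and> length ws' = ar \<Theta> f \<and>
        set ws \<subseteq> carr (W \<Theta> X) \<and> set ws' \<subseteq> carr (W \<Theta> X)"
    let ?e = "foldr HMeet (map2 HEq ws ws') HTop"
    have e: "of_sort \<Theta> X0 ?e X" "foldr (hmeet (Phi \<Theta> X0) X) (map2 (heq (Phi \<Theta> X0) X) ws ws') (htop (Phi \<Theta> X0) X) =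
      hcls \<Theta> X0 X ?e" using foldr_Phi[OF X, of ws ws' \<Theta>] a by auto
    have "hcls \<Theta> X0 X (HMeet ?e (HEq (interp (W \<Theta> X) f ws) (interp (W \<Theta> X) f ws'))) = hcls \<Theta> X0 X ?e"
      by (rule hcls_ax[OF hax.eq_op[OF f]]) (use a e W f X in auto)
    then show "hmeet (Phi \<Theta> X0) X (foldr (hmeet (Phi \<Theta> X0) X) (map2 (heq (Phi \<Theta> X0) X) ws ws') (htop (Phi \<Theta> X0) X))
          (heq (Phi \<Theta> X0) X (interp (W \<Theta> X) f ws) (interp (W \<Theta> X) f ws')) =
         foldr (hmeet (Phi \<Theta> X0) X) (map2 (heq (Phi \<Theta> X0) X) ws ws') (htop (Phi \<Theta> X0) X)"
      using e W f a by (simp add: Phi_simps Phi_ops[OF X])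
  next
    fix x a assume "x \<in> X" "a \<in> hdom (Phi \<Theta> X0) X"
    then show "hmeet (Phi \<Theta> X0) X a (hex (Phi \<Theta> X0) X x a) = a"
      by (clarsimp simp: Phi_simps Phi_ops[OF X]) (rule hcls_ax[OF hax.ex_incr]; simp add: X)
  next
    fix x a b assume "x \<in> X" "a \<in> hdom (Phi \<Theta> X0) X" "b \<in> hdom (Phi \<Theta> X0) X"
    then show "hex (Phi \<Theta> X0) X x (hmeet (Phi \<Theta> X0) X a (hex (Phi \<Theta> X0) X x b)) =
       hmeet (Phi \<Theta> X0) X (hex (Phi \<Theta> X0) X x a) (hex (Phi \<Theta> X0) X x b)"
      by (clarsimp simp: Phi_simps Phi_ops[OF X]) (rule hcls_ax[OF hax.ex_meet]; simp add: X)
  next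
    fix x y a assume "x \<in> X" "y \<in> X" "a \<in> hdom (Phi \<Theta> X0) X"
    then show "hex (Phi \<Theta> X0) X x (hex (Phi \<Theta> X0) X y a) = hex (Phi \<Theta> X0) X y (hex (Phi \<Theta> X0) X x a)"
      by (clarsimp simp: Phi_simps Phi_ops[OF X]) (rule hcls_ax[OF hax.ex_comm]; simp add: X)
  qed (auto simp: Phi_simps Phi_ops[OF X] hcls_eq X intro!: hcong.ax intro: hax.intros)
  show ?thesis
    unfolding halmos_algebra_def Let_def
  proof (intro conjI ballI allI impI es)
    fix X Y s assume "X \<in> Gams X0" "Y \<in> Gams X0" "s \<in> Hom \<Theta> (W \<Theta> X) (W \<Theta> Y)"
    then show "boolean_hom_between (Phi \<Theta> X0) X (Phi \<Theta> X0) Y (hsub (Phi \<Theta> X0) X Y s)"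
      by (auto simp: boolean_hom_between_def Phi_simps Phi_ops hcls_eq intro!: hcong.ax intro: hax.intros)
  next
    fix X a assume X: "X \<in> Gams X0" and "a \<in> hdom (Phi \<Theta> X0) X"
    moreover have "in_variety \<Theta> (W \<Theta> X)" by (rule W_in_variety[OF v])
    then have "(\<lambda>w \<in> carr (W \<Theta> X). w) \<in> Hom \<Theta> (W \<Theta> X) (W \<Theta> X)"
      unfolding Hom_def in_variety_def by (auto simp: subset_iff intro!: arg_cong[where f = "interp (W \<Theta> X) _"] map_idI[symmetric])
    ultimately show "hsub (Phi \<Theta> X0) X X (\<lambda>w \<in> carr (W \<Theta> X). w) a = a"
      by (clarsimp simp: Phi_simps Phi_ops) (rule hcls_ax[OF hax.sub_id]; simp)
  next
    fix X Y Z s s' a assume "X \<in> Gams X0" "Y \<in> Gams X0" "Z \<in> Gams X0"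
      "s \<in> Hom \<Theta> (W \<Theta> X) (W \<Theta> Y)" "s' \<in> Hom \<Theta> (W \<Theta> Y) (W \<Theta> Z)" "a \<in> hdom (Phi \<Theta> X0) X"
    then show "hsub (Phi \<Theta> X0) X Z (compose (carr (W \<Theta> X)) s' s) a = hsub (Phi \<Theta> X0) Y Z s' (hsub (Phi \<Theta> X0) X Y s a)"
      using Hom_compose[OF v, of s X Y s'] by (clarsimp simp: Phi_simps Phi_ops) (rule hcls_ax[OF hax.sub_comp]; simp)
  next
    fix X x w w' s s' a assume "X \<in> Gams X0" "x \<in> X" "w \<in> carr (W \<Theta> X)" "w' \<in> carr (W \<Theta> X)"
      "a \<in> hdom (Phi \<Theta> X0) X" "one_subst \<Theta> X x w s \<and> one_subst \<Theta> X x w' s'"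
    moreover from this have "s \<in> Hom \<Theta> (W \<Theta> X) (W \<Theta> X)" "s' \<in> Hom \<Theta> (W \<Theta> X) (W \<Theta> X)"
      by (auto simp: one_subst_def)
    ultimately show "hmeet (Phi \<Theta> X0) X (hmeet (Phi \<Theta> X0) X (hsub (Phi \<Theta> X0) X X s a) (heq (Phi \<Theta> X0) X w w'))
         (hsub (Phi \<Theta> X0) X X s' a) = hmeet (Phi \<Theta> X0) X (hsub (Phi \<Theta> X0) X X s a) (heq (Phi \<Theta> X0) X w w')"
      by (clarsimp simp: Phi_simps Phi_ops) (rule hcls_ax[OF hax.sub_one[where x = x and w = w and w' = w']]; simp)
  next
    fix X Y s x y a assume "X \<in> Gams X0" "Y \<in> Gams X0" "s \<in> Hom \<Theta> (W \<Theta> X) (W \<Theta> Y)"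
      "a \<in> hdom (Phi \<Theta> X0) X" "fresh_subst \<Theta> X Y s x y"
    moreover from this have "x \<in> X" "y \<in> Y" by (auto simp: fresh_subst_def)
    ultimately show "hsub (Phi \<Theta> X0) X Y s (hex (Phi \<Theta> X0) X x a) = hex (Phi \<Theta> X0) Y y (hsub (Phi \<Theta> X0) X Y s a)"
      by (clarsimp simp: Phi_simps Phi_ops) (rule hcls_ax[OF hax.sub_ex_fresh]; simp)
  next
    fix X Y s s' x a assume "X \<in> Gams X0" "Y \<in> Gams X0" "s \<in> Hom \<Theta> (W \<Theta> X) (W \<Theta> Y)"
      "s' \<in> Hom \<Theta> (W \<Theta> X) (W \<Theta> Y)" "x \<in> X" "a \<in> hdom (Phi \<Theta> X0) X" "agree_off \<Theta> X x s s'"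
    then show "hsub (Phi \<Theta> X0) X Y s (hex (Phi \<Theta> X0) X x a) = hsub (Phi \<Theta> X0) X Y s' (hex (Phi \<Theta> X0) X x a)"
      by (clarsimp simp: Phi_simps Phi_ops) (rule hcls_ax[OF hax.sub_ex_agree]; simp)
  next
    fix X Y s w w' assume "X \<in> Gams X0" "Y \<in> Gams X0" "s \<in> Hom \<Theta> (W \<Theta> X) (W \<Theta> Y)"
      "w \<in> carr (W \<Theta> X)" "w' \<in> carr (W \<Theta> X)"
    moreover from this have "s w \<in> carr (W \<Theta> Y)" "s w' \<in> carr (W \<Theta> Y)" by (simp_all add: Hom_carr)
    ultimately show "hsub (Phi \<Theta> X0) X Y s (heq (Phi \<Theta> X0) X w w') = heq (Phi \<Theta> X0) Y (s w) (s w')"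
      by (clarsimp simp: Phi_simps Phi_ops) (rule hcls_ax[OF hax.sub_eq]; simp)
  qed
qed

primrec heval :: "('f, 'v, 'b) halmos \<Rightarrow> ('f, 'v) hterm \<Rightarrow> 'v set \<Rightarrow> 'b" where
  "heval L (HEq w w') X = heq L X w w'"
| "heval L HBot X = hbot L X"
| "heval L HTop X = htop L X"
| "heval L (HNeg p) X = hneg L X (heval L p X)"
| "heval L (HMeet p q) X = hmeet L X (heval L p X) (heval L q X)"
| "heval L (HJoin p q) X = hjoin L X (heval L p X) (heval L q X)"
| "heval L (HEx x p) X = hex L X x (heval L p X)"
| "heval L (HSub Y s p) X = hsub L Y X s (heval L p Y)"

lemma heval_foldr: "length ws = length ws' \<Longrightarrow> heval L (foldr HMeet (map2 HEq ws ws') HTop) X =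
    foldr (hmeet L X) (map2 (heq L X) ws ws') (htop L X)"
  by (induction ws ws' rule: list_induct2) auto

lemma halmosD:
  assumes "halmos_algebra \<Theta> X0 L" "X \<in> Gams X0"
  shows "extended_boolean_sort \<Theta> L X"
    "Y \<in> Gams X0 \<Longrightarrow> s \<in> Hom \<Theta> (W \<Theta> X) (W \<Theta> Y) \<Longrightarrow> boolean_hom_between L X L Y (hsub L X Y s)"
    "a \<in> hdom L X \<Longrightarrow> hsub L X X (\<lambda>w \<in> carr (W \<Theta> X). w) a = a"
    "Y \<in> Gams X0 \<Longrightarrow> Z \<in> Gams X0 \<Longrightarrow> s \<in> Hom \<Theta> (W \<Theta> X) (W \<Theta> Y) \<Longrightarrow>
      s' \<in> Hom \<Theta> (W \<Theta> Y) (W \<Theta> Z) \<Longrightarrow> a \<in> hdom L X \<Longrightarrow>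
      hsub L X Z (compose (carr (W \<Theta> X)) s' s) a = hsub L Y Z s' (hsub L X Y s a)"
    "Y \<in> Gams X0 \<Longrightarrow> s \<in> Hom \<Theta> (W \<Theta> X) (W \<Theta> Y) \<Longrightarrow> s' \<in> Hom \<Theta> (W \<Theta> X) (W \<Theta> Y) \<Longrightarrow> x \<in> X \<Longrightarrow>
      a \<in> hdom L X \<Longrightarrow> agree_off \<Theta> X x s s' \<Longrightarrow> hsub L X Y s (hex L X x a) = hsub L X Y s' (hex L X x a)"
    "Y \<in> Gams X0 \<Longrightarrow> s \<in> Hom \<Theta> (W \<Theta> X) (W \<Theta> Y) \<Longrightarrow> a \<in> hdom L X \<Longrightarrow>
      fresh_subst \<Theta> X Y s x y \<Longrightarrow> hsub L X Y s (hex L X x a) = hex L Y y (hsub L X Y s a)"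
    "Y \<in> Gams X0 \<Longrightarrow> s \<in> Hom \<Theta> (W \<Theta> X) (W \<Theta> Y) \<Longrightarrow> w \<in> carr (W \<Theta> X) \<Longrightarrow> w' \<in> carr (W \<Theta> X) \<Longrightarrow>
      hsub L X Y s (heq L X w w') = heq L Y (s w) (s w')"
    "x \<in> X \<Longrightarrow> w \<in> carr (W \<Theta> X) \<Longrightarrow> w' \<in> carr (W \<Theta> X) \<Longrightarrow> a \<in> hdom L X \<Longrightarrow>
      one_subst \<Theta> X x w s \<Longrightarrow> one_subst \<Theta> X x w' s' \<Longrightarrow>
      hmeet L X (hmeet L X (hsub L X X s a) (heq L X w w')) (hsub L X X s' a) =
      hmeet L X (hsub L X X s a) (heq L X w w')"
proof -
  note D = assms(1)[unfolded halmos_algebra_def Let_def]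
  show "extended_boolean_sort \<Theta> L X"
    by (rule D[THEN conjunct1, rule_format, OF assms(2)])
  show "Y \<in> Gams X0 \<Longrightarrow> s \<in> Hom \<Theta> (W \<Theta> X) (W \<Theta> Y) \<Longrightarrow> boolean_hom_between L X L Y (hsub L X Y s)"
    by (rule D[THEN conjunct2, THEN conjunct1, rule_format, OF assms(2)]) (assumption | rule conjI)+
  show "a \<in> hdom L X \<Longrightarrow> hsub L X X (\<lambda>w \<in> carr (W \<Theta> X). w) a = a"
    by (rule D[THEN conjunct2, THEN conjunct2, THEN conjunct1, rule_format, OF assms(2)]) (assumption | rule conjI)+
  show "Y \<in> Gams X0 \<Longrightarrow> Z \<in> Gams X0 \<Longrightarrow> s \<in> Hom \<Theta> (W \<Theta> X) (W \<Theta> Y) \<Longrightarrow>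
      s' \<in> Hom \<Theta> (W \<Theta> Y) (W \<Theta> Z) \<Longrightarrow> a \<in> hdom L X \<Longrightarrow>
      hsub L X Z (compose (carr (W \<Theta> X)) s' s) a = hsub L Y Z s' (hsub L X Y s a)"
    by (rule D[THEN conjunct2, THEN conjunct2, THEN conjunct2, THEN conjunct1, rule_format, OF assms(2)]) (assumption | rule conjI)+
  show "Y \<in> Gams X0 \<Longrightarrow> s \<in> Hom \<Theta> (W \<Theta> X) (W \<Theta> Y) \<Longrightarrow> s' \<in> Hom \<Theta> (W \<Theta> X) (W \<Theta> Y) \<Longrightarrow> x \<in> X \<Longrightarrow>
      a \<in> hdom L X \<Longrightarrow> agree_off \<Theta> X x s s' \<Longrightarrow> hsub L X Y s (hex L X x a) = hsub L X Y s' (hex L X x a)"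
    by (rule D[THEN conjunct2, THEN conjunct2, THEN conjunct2, THEN conjunct2, THEN conjunct1, rule_format, OF assms(2)]) (assumption | rule conjI)+
  show "Y \<in> Gams X0 \<Longrightarrow> s \<in> Hom \<Theta> (W \<Theta> X) (W \<Theta> Y) \<Longrightarrow> a \<in> hdom L X \<Longrightarrow>
      fresh_subst \<Theta> X Y s x y \<Longrightarrow> hsub L X Y s (hex L X x a) = hex L Y y (hsub L X Y s a)"
    by (rule D[THEN conjunct2, THEN conjunct2, THEN conjunct2, THEN conjunct2, THEN conjunct2, THEN conjunct1, rule_format, OF assms(2)]) (assumption | rule conjI)+
  show "Y \<in> Gams X0 \<Longrightarrow> s \<in> Hom \<Theta> (W \<Theta> X) (W \<Theta> Y) \<Longrightarrow> w \<in> carr (W \<Theta> X) \<Longrightarrow> w' \<in> carr (W \<Theta> X) \<Longrightarrow>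
      hsub L X Y s (heq L X w w') = heq L Y (s w) (s w')"
    by (rule D[THEN conjunct2, THEN conjunct2, THEN conjunct2, THEN conjunct2, THEN conjunct2, THEN conjunct2, THEN conjunct1, rule_format, OF assms(2)]) (assumption | rule conjI)+
  show "x \<in> X \<Longrightarrow> w \<in> carr (W \<Theta> X) \<Longrightarrow> w' \<in> carr (W \<Theta> X) \<Longrightarrow> a \<in> hdom L X \<Longrightarrow>
      one_subst \<Theta> X x w s \<Longrightarrow> one_subst \<Theta> X x w' s' \<Longrightarrow>
      hmeet L X (hmeet L X (hsub L X X s a) (heq L X w w')) (hsub L X X s' a) =
      hmeet L X (hsub L X X s a) (heq L X w w')"
    by (rule D[THEN conjunct2, THEN conjunct2, THEN conjunct2, THEN conjunct2, THEN conjunct2, THEN conjunct2, THEN conjunct2, rule_format, OF assms(2)]) (assumption | rule conjI)+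
qed

lemma sortD:
  assumes "extended_boolean_sort \<Theta> L X"
  shows "hbot L X \<in> hdom L X"
    "htop L X \<in> hdom L X"
    "a \<in> hdom L X \<Longrightarrow> hneg L X a \<in> hdom L X"
    "a \<in> hdom L X \<Longrightarrow> b \<in> hdom L X \<Longrightarrow> hmeet L X a b \<in> hdom L X"
    "a \<in> hdom L X \<Longrightarrow> b \<in> hdom L X \<Longrightarrow> hjoin L X a b \<in> hdom L X"
    "x \<in> X \<Longrightarrow> a \<in> hdom L X \<Longrightarrow> hex L X x a \<in> hdom L X"
    "w \<in> carr (W \<Theta> X) \<Longrightarrow> w' \<in> carr (W \<Theta> X) \<Longrightarrow> heq L X w w' \<in> hdom L X"
    "a \<in> hdom L X \<Longrightarrow> hmeet L X a (htop L X) = a"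
    "a \<in> hdom L X \<Longrightarrow> hjoin L X a (hbot L X) = a"
    "a \<in> hdom L X \<Longrightarrow> hmeet L X a (hneg L X a) = hbot L X"
    "a \<in> hdom L X \<Longrightarrow> hjoin L X a (hneg L X a) = htop L X"
    "a \<in> hdom L X \<Longrightarrow> b \<in> hdom L X \<Longrightarrow> hmeet L X a b = hmeet L X b a"
    "a \<in> hdom L X \<Longrightarrow> b \<in> hdom L X \<Longrightarrow> hjoin L X a b = hjoin L X b a"
    "a \<in> hdom L X \<Longrightarrow> b \<in> hdom L X \<Longrightarrow> c \<in> hdom L X \<Longrightarrow>
      hmeet L X a (hjoin L X b c) = hjoin L X (hmeet L X a b) (hmeet L X a c)"
    "a \<in> hdom L X \<Longrightarrow> b \<in> hdom L X \<Longrightarrow> c \<in> hdom L X \<Longrightarrow>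
      hjoin L X a (hmeet L X b c) = hmeet L X (hjoin L X a b) (hjoin L X a c)"
    "x \<in> X \<Longrightarrow> hex L X x (hbot L X) = hbot L X"
    "x \<in> X \<Longrightarrow> a \<in> hdom L X \<Longrightarrow> hmeet L X a (hex L X x a) = a"
    "x \<in> X \<Longrightarrow> a \<in> hdom L X \<Longrightarrow> b \<in> hdom L X \<Longrightarrow>
      hex L X x (hmeet L X a (hex L X x b)) = hmeet L X (hex L X x a) (hex L X x b)"
    "x \<in> X \<Longrightarrow> y \<in> X \<Longrightarrow> a \<in> hdom L X \<Longrightarrow> hex L X x (hex L X y a) = hex L X y (hex L X x a)"
    "w \<in> carr (W \<Theta> X) \<Longrightarrow> heq L X w w = htop L X"
    "f \<in> ops \<Theta> \<Longrightarrow> length ws = ar \<Theta> f \<Longrightarrow> length ws' = ar \<Theta> f \<Longrightarrow>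
      set ws \<subseteq> carr (W \<Theta> X) \<Longrightarrow> set ws' \<subseteq> carr (W \<Theta> X) \<Longrightarrow>
      e = foldr (hmeet L X) (map2 (heq L X) ws ws') (htop L X) \<Longrightarrow>
      hmeet L X e (heq L X (interp (W \<Theta> X) f ws) (interp (W \<Theta> X) f ws')) = e"
proof -
  note D = assms(1)[unfolded extended_boolean_sort_def boolean_sort_def Let_def]
  show "hbot L X \<in> hdom L X"
    by (rule D[THEN conjunct1, THEN conjunct1, rule_format])
  show "htop L X \<in> hdom L X"
    by (rule D[THEN conjunct1, THEN conjunct2, THEN conjunct1, rule_format])
  show "a \<in> hdom L X \<Longrightarrow> hneg L X a \<in> hdom L X"
    by (rule D[THEN conjunct1, THEN conjunct2, THEN conjunct2, THEN conjunct1, rule_format, THEN conjunct1]) (assumption | rule conjI)+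
  show "a \<in> hdom L X \<Longrightarrow> b \<in> hdom L X \<Longrightarrow> hmeet L X a b \<in> hdom L X"
    by (rule D[THEN conjunct1, THEN conjunct2, THEN conjunct2, THEN conjunct2, THEN conjunct1, rule_format, THEN conjunct1]) (assumption | rule conjI)+
  show "a \<in> hdom L X \<Longrightarrow> b \<in> hdom L X \<Longrightarrow> hjoin L X a b \<in> hdom L X"
    by (rule D[THEN conjunct1, THEN conjunct2, THEN conjunct2, THEN conjunct2, THEN conjunct1, rule_format, THEN conjunct2, THEN conjunct1]) (assumption | rule conjI)+
  show "x \<in> X \<Longrightarrow> a \<in> hdom L X \<Longrightarrow> hex L X x a \<in> hdom L X"
    by (rule D[THEN conjunct2, THEN conjunct2, THEN conjunct1, rule_format, THEN conjunct1]) (assumption | rule conjI)+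
  show "w \<in> carr (W \<Theta> X) \<Longrightarrow> w' \<in> carr (W \<Theta> X) \<Longrightarrow> heq L X w w' \<in> hdom L X"
    by (rule D[THEN conjunct2, THEN conjunct2, THEN conjunct2, THEN conjunct2, THEN conjunct2, THEN conjunct1, rule_format]) (assumption | rule conjI)+
  show "a \<in> hdom L X \<Longrightarrow> hmeet L X a (htop L X) = a"
    by (rule D[THEN conjunct1, THEN conjunct2, THEN conjunct2, THEN conjunct1, rule_format, THEN conjunct2, THEN conjunct1]) (assumption | rule conjI)+
  show "a \<in> hdom L X \<Longrightarrow> hjoin L X a (hbot L X) = a"
    by (rule D[THEN conjunct1, THEN conjunct2, THEN conjunct2, THEN conjunct1, rule_format, THEN conjunct2, THEN conjunct2, THEN conjunct1]) (assumption | rule conjI)+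
  show "a \<in> hdom L X \<Longrightarrow> hmeet L X a (hneg L X a) = hbot L X"
    by (rule D[THEN conjunct1, THEN conjunct2, THEN conjunct2, THEN conjunct1, rule_format, THEN conjunct2, THEN conjunct2, THEN conjunct2, THEN conjunct1]) (assumption | rule conjI)+
  show "a \<in> hdom L X \<Longrightarrow> hjoin L X a (hneg L X a) = htop L X"
    by (rule D[THEN conjunct1, THEN conjunct2, THEN conjunct2, THEN conjunct1, rule_format, THEN conjunct2, THEN conjunct2, THEN conjunct2, THEN conjunct2]) (assumption | rule conjI)+
  show "a \<in> hdom L X \<Longrightarrow> b \<in> hdom L X \<Longrightarrow> hmeet L X a b = hmeet L X b a"
    by (rule D[THEN conjunct1, THEN conjunct2, THEN conjunct2, THEN conjunct2, THEN conjunct1, rule_format, THEN conjunct2, THEN conjunct2, THEN conjunct1]) (assumption | rule conjI)+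
  show "a \<in> hdom L X \<Longrightarrow> b \<in> hdom L X \<Longrightarrow> hjoin L X a b = hjoin L X b a"
    by (rule D[THEN conjunct1, THEN conjunct2, THEN conjunct2, THEN conjunct2, THEN conjunct1, rule_format, THEN conjunct2, THEN conjunct2, THEN conjunct2]) (assumption | rule conjI)+
  show "a \<in> hdom L X \<Longrightarrow> b \<in> hdom L X \<Longrightarrow> c \<in> hdom L X \<Longrightarrow>
      hmeet L X a (hjoin L X b c) = hjoin L X (hmeet L X a b) (hmeet L X a c)"
    by (rule D[THEN conjunct1, THEN conjunct2, THEN conjunct2, THEN conjunct2, THEN conjunct2, rule_format, THEN conjunct1]) (assumption | rule conjI)+
  show "a \<in> hdom L X \<Longrightarrow> b \<in> hdom L X \<Longrightarrow> c \<in> hdom L X \<Longrightarrow>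
      hjoin L X a (hmeet L X b c) = hmeet L X (hjoin L X a b) (hjoin L X a c)"
    by (rule D[THEN conjunct1, THEN conjunct2, THEN conjunct2, THEN conjunct2, THEN conjunct2, rule_format, THEN conjunct2]) (assumption | rule conjI)+
  show "x \<in> X \<Longrightarrow> hex L X x (hbot L X) = hbot L X"
    by (rule D[THEN conjunct2, THEN conjunct1, rule_format]) (assumption | rule conjI)+
  show "x \<in> X \<Longrightarrow> a \<in> hdom L X \<Longrightarrow> hmeet L X a (hex L X x a) = a"
    by (rule D[THEN conjunct2, THEN conjunct2, THEN conjunct1, rule_format, THEN conjunct2]) (assumption | rule conjI)+
  show "x \<in> X \<Longrightarrow> a \<in> hdom L X \<Longrightarrow> b \<in> hdom L X \<Longrightarrow>
      hex L X x (hmeet L X a (hex L X x b)) = hmeet L X (hex L X x a) (hex L X x b)"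
    by (rule D[THEN conjunct2, THEN conjunct2, THEN conjunct2, THEN conjunct1, rule_format]) (assumption | rule conjI)+
  show "x \<in> X \<Longrightarrow> y \<in> X \<Longrightarrow> a \<in> hdom L X \<Longrightarrow> hex L X x (hex L X y a) = hex L X y (hex L X x a)"
    by (rule D[THEN conjunct2, THEN conjunct2, THEN conjunct2, THEN conjunct2, THEN conjunct1, rule_format]) (assumption | rule conjI)+
  show "w \<in> carr (W \<Theta> X) \<Longrightarrow> heq L X w w = htop L X"
    by (rule D[THEN conjunct2, THEN conjunct2, THEN conjunct2, THEN conjunct2, THEN conjunct2, THEN conjunct2, THEN conjunct1, rule_format]) (assumption | rule conjI)+
  show "f \<in> ops \<Theta> \<Longrightarrow> length ws = ar \<Theta> f \<Longrightarrow> length ws' = ar \<Theta> f \<Longrightarrow>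
      set ws \<subseteq> carr (W \<Theta> X) \<Longrightarrow> set ws' \<subseteq> carr (W \<Theta> X) \<Longrightarrow>
      e = foldr (hmeet L X) (map2 (heq L X) ws ws') (htop L X) \<Longrightarrow>
      hmeet L X e (heq L X (interp (W \<Theta> X) f ws) (interp (W \<Theta> X) f ws')) = e"
    by (hypsubst, rule D[THEN conjunct2, THEN conjunct2, THEN conjunct2, THEN conjunct2, THEN conjunct2, THEN conjunct2, THEN conjunct2, rule_format]) (assumption | rule conjI)+
qed

lemma homD:
  assumes "boolean_hom_between L X L' Y h"
  shows "h (hbot L X) = hbot L' Y"
    "h (htop L X) = htop L' Y"
    "a \<in> hdom L X \<Longrightarrow> h a \<in> hdom L' Y"
    "a \<in> hdom L X \<Longrightarrow> h (hneg L X a) = hneg L' Y (h a)"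
    "a \<in> hdom L X \<Longrightarrow> b \<in> hdom L X \<Longrightarrow> h (hmeet L X a b) = hmeet L' Y (h a) (h b)"
    "a \<in> hdom L X \<Longrightarrow> b \<in> hdom L X \<Longrightarrow> h (hjoin L X a b) = hjoin L' Y (h a) (h b)"
proof -
  note D = assms(1)[unfolded boolean_hom_between_def]
  show "h (hbot L X) = hbot L' Y"
    by (rule D[THEN conjunct1, rule_format])
  show "h (htop L X) = htop L' Y"
    by (rule D[THEN conjunct2, THEN conjunct1, rule_format])
  show "a \<in> hdom L X \<Longrightarrow> h a \<in> hdom L' Y"
    by (rule D[THEN conjunct2, THEN conjunct2, THEN conjunct1, rule_format, THEN conjunct1]) (assumption | rule conjI)+
  show "a \<in> hdom L X \<Longrightarrow> h (hneg L X a) = hneg L' Y (h a)"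
    by (rule D[THEN conjunct2, THEN conjunct2, THEN conjunct1, rule_format, THEN conjunct2]) (assumption | rule conjI)+
  show "a \<in> hdom L X \<Longrightarrow> b \<in> hdom L X \<Longrightarrow> h (hmeet L X a b) = hmeet L' Y (h a) (h b)"
    by (rule D[THEN conjunct2, THEN conjunct2, THEN conjunct2, rule_format, THEN conjunct1]) (assumption | rule conjI)+
  show "a \<in> hdom L X \<Longrightarrow> b \<in> hdom L X \<Longrightarrow> h (hjoin L X a b) = hjoin L' Y (h a) (h b)"
    by (rule D[THEN conjunct2, THEN conjunct2, THEN conjunct2, rule_format, THEN conjunct2]) (assumption | rule conjI)+
qed

lemma halmos_homD:
  assumes "halmos_hom \<Theta> X0 L L' h" "X \<in> Gams X0"
  shows "h X \<in> hdom L X \<rightarrow>\<^sub>E hdom L' X"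
    "boolean_hom_between L X L' X (h X)"
    "x \<in> X \<Longrightarrow> a \<in> hdom L X \<Longrightarrow> h X (hex L X x a) = hex L' X x (h X a)"
    "w \<in> carr (W \<Theta> X) \<Longrightarrow> w' \<in> carr (W \<Theta> X) \<Longrightarrow> h X (heq L X w w') = heq L' X w w'"
    "Y \<in> Gams X0 \<Longrightarrow> s \<in> Hom \<Theta> (W \<Theta> X) (W \<Theta> Y) \<Longrightarrow> a \<in> hdom L X \<Longrightarrow>
      h Y (hsub L X Y s a) = hsub L' X Y s (h X a)"
proof -
  note D = assms(1)[unfolded halmos_hom_def]
  show "h X \<in> hdom L X \<rightarrow>\<^sub>E hdom L' X"
    by (rule PiE_mem[OF D[THEN conjunct1] assms(2)])
  show "boolean_hom_between L X L' X (h X)"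
    by (rule D[THEN conjunct2, THEN conjunct1, rule_format, OF assms(2)])
  show "x \<in> X \<Longrightarrow> a \<in> hdom L X \<Longrightarrow> h X (hex L X x a) = hex L' X x (h X a)"
    by (rule D[THEN conjunct2, THEN conjunct2, THEN conjunct1, rule_format, OF assms(2)]) (assumption | rule conjI)+
  show "w \<in> carr (W \<Theta> X) \<Longrightarrow> w' \<in> carr (W \<Theta> X) \<Longrightarrow> h X (heq L X w w') = heq L' X w w'"
    by (rule D[THEN conjunct2, THEN conjunct2, THEN conjunct2, THEN conjunct1, rule_format, OF assms(2)]) (assumption | rule conjI)+
  show "Y \<in> Gams X0 \<Longrightarrow> s \<in> Hom \<Theta> (W \<Theta> X) (W \<Theta> Y) \<Longrightarrow> a \<in> hdom L X \<Longrightarrow>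
      h Y (hsub L X Y s a) = hsub L' X Y s (h X a)"
    by (rule D[THEN conjunct2, THEN conjunct2, THEN conjunct2, THEN conjunct2, rule_format, OF assms(2)]) (assumption | rule conjI)+
qed

lemma heval_closed:
  assumes L: "halmos_algebra \<Theta> X0 L"
  shows "of_sort \<Theta> X0 p X \<Longrightarrow> X \<in> Gams X0 \<Longrightarrow> heval L p X \<in> hdom L X"
  by (induction p arbitrary: X) (auto intro: sortD[OF halmosD(1)[OF L]] homD[OF halmosD(2)[OF L]])

lemma hax_sound:
  assumes L: "halmos_algebra \<Theta> X0 L" and a: "hax \<Theta> X p q"
    and p: "of_sort \<Theta> X0 p X" and q: "of_sort \<Theta> X0 q X" and X: "X \<in> Gams X0"
  shows "heval L p X = heval L q X"
proof -
  note [intro] = heval_closed[OF L] X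
  note S = sortD[OF halmosD(1)[OF L X]]
  note B = homD[OF halmosD(2)[OF L]]
  from a p q show ?thesis
  proof (induction rule: hax.induct)
    case (eq_op f ws ws' e)
    then have "heval L e X = foldr (hmeet L X) (map2 (heq L X) ws ws') (htop L X)"
      using heval_foldr by metis
    then show ?case using S(21)[OF eq_op(1-5)] by simp
  next
    case meet_comm then show ?case by (auto intro: S(12))
  next
    case join_comm then show ?case by (auto intro: S(13))
  next
    case meet_join then show ?case by (auto intro: S(14))
  next
    case join_meet then show ?case by (auto intro: S(15))
  next
    case ex_comm then show ?case by (auto intro: S(19))
  next
    case ex_meet then show ?case by (auto intro: S(18))
  next
    case (sub_comp Z s' s p Y) then show ?case by (auto intro!: halmosD(4)[OF L])
  next
    case (sub_ex_agree Y x s s' p) then show ?case by (auto intro!: halmosD(5)[OF L])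
  next
    case (sub_ex_fresh Y s x y p) then show ?case by (auto intro!: halmosD(6)[OF L])
  next
    case (sub_eq Y s w w') then show ?case by (auto intro!: halmosD(7)[OF L])
  next
    case (sub_one x w s w' s' e p) then show ?case by (auto intro!: halmosD(8)[OF L X, where x = x])
  qed (auto intro: S(8-11,16,17,20) B halmosD(3)[OF L X])
qed

lemma hcong_sound:
  assumes L: "halmos_algebra \<Theta> X0 L"
  shows "hcong \<Theta> X0 X p q \<Longrightarrow> heval L p X = heval L q X"
  by (induction rule: hcong.induct) (use hax_sound[OF L] in auto)

theorem Phi_free:
  assumes v: "is_variety \<Theta>" and L: "halmos_algebra \<Theta> X0 L"
  shows "\<exists>!h. halmos_hom \<Theta> X0 (Phi \<Theta> X0) L h"
    and "halmos_hom \<Theta> X0 (Phi \<Theta> X0) L h \<Longrightarrow> X \<in> Gams X0 \<Longrightarrow> of_sort \<Theta> X0 p X \<Longrightarrow>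
      h X (hcls \<Theta> X0 X p) = heval L p X"
proof -
  have ev: "h X (hcls \<Theta> X0 X p) = heval L p X"
    if h: "halmos_hom \<Theta> X0 (Phi \<Theta> X0) L h" and "X \<in> Gams X0" "of_sort \<Theta> X0 p X" for h X p
    using that(2,3)
  proof (induction p arbitrary: X)
    case (HNeg p)
    then have "h X (hneg (Phi \<Theta> X0) X (hcls \<Theta> X0 X p)) = hneg L X (h X (hcls \<Theta> X0 X p))"
      by (intro homD(4)[OF halmos_homD(2)[OF h]]) (auto simp: Phi_simps)
    then show ?case using HNeg by (simp add: Phi_ops)
  next
    case (HMeet p q)
    then have "h X (hmeet (Phi \<Theta> X0) X (hcls \<Theta> X0 X p) (hcls \<Theta> X0 X q)) =
        hmeet L X (h X (hcls \<Theta> X0 X p)) (h X (hcls \<Theta> X0 X q))"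
      by (intro homD(5)[OF halmos_homD(2)[OF h]]) (auto simp: Phi_simps)
    then show ?case using HMeet by (simp add: Phi_ops)
  next
    case (HJoin p q)
    then have "h X (hjoin (Phi \<Theta> X0) X (hcls \<Theta> X0 X p) (hcls \<Theta> X0 X q)) =
        hjoin L X (h X (hcls \<Theta> X0 X p)) (h X (hcls \<Theta> X0 X q))"
      by (intro homD(6)[OF halmos_homD(2)[OF h]]) (auto simp: Phi_simps)
    then show ?case using HJoin by (simp add: Phi_ops)
  next
    case (HEx x p)
    then have "h X (hex (Phi \<Theta> X0) X x (hcls \<Theta> X0 X p)) = hex L X x (h X (hcls \<Theta> X0 X p))"
      by (intro halmos_homD(3)[OF h]) (auto simp: Phi_simps)
    then show ?case using HEx by (simp add: Phi_ops)
  next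
    case (HSub Y s p)
    then have "h X (hsub (Phi \<Theta> X0) Y X s (hcls \<Theta> X0 Y p)) = hsub L Y X s (h Y (hcls \<Theta> X0 Y p))"
      by (intro halmos_homD(5)[OF h]) (auto simp: Phi_simps)
    then show ?case using HSub by (simp add: Phi_ops)
  next
    case (HEq w w')
    then show ?case using halmos_homD(4)[OF h, of X w w'] by (simp add: Phi_simps)
  next
    case HBot
    then show ?case using homD(1)[OF halmos_homD(2)[OF h]] by (simp add: Phi_simps)
  next
    case HTop
    then show ?case using homD(2)[OF halmos_homD(2)[OF h]] by (simp add: Phi_simps)
  qed
  then show "halmos_hom \<Theta> X0 (Phi \<Theta> X0) L h \<Longrightarrow> X \<in> Gams X0 \<Longrightarrow> of_sort \<Theta> X0 p X \<Longrightarrow>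
      h X (hcls \<Theta> X0 X p) = heval L p X" .
  define h where "h = (\<lambda>X \<in> Gams X0. \<lambda>a \<in> hdom (Phi \<Theta> X0) X. heval L (SOME p. p \<in> a) X)"
  have hv: "h X (hcls \<Theta> X0 X p) = heval L p X" if "X \<in> Gams X0" "of_sort \<Theta> X0 p X" for X p
  proof -
    have "(SOME q. q \<in> hcls \<Theta> X0 X p) \<in> hcls \<Theta> X0 X p" by (rule someI) (rule hcls_ne[OF that(2,1)])
    then have "hcong \<Theta> X0 X p (SOME q. q \<in> hcls \<Theta> X0 X p)" by (simp add: hcls_def)
    then show ?thesis using hcong_sound[OF L] that by (auto simp: h_def Phi_simps)
  qed
  have cl: "\<And>p X. of_sort \<Theta> X0 p X \<Longrightarrow> X \<in> Gams X0 \<Longrightarrow> heval L p X \<in> hdom L X"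
    by (rule heval_closed[OF L])
  have "halmos_hom \<Theta> X0 (Phi \<Theta> X0) L h"
    unfolding halmos_hom_def boolean_hom_between_def
  proof (intro conjI)
    show "h \<in> (\<Pi>\<^sub>E X \<in> Gams X0. hdom (Phi \<Theta> X0) X \<rightarrow>\<^sub>E hdom L X)"
    proof (intro PiE_I)
      fix X a assume "X \<in> Gams X0" "a \<in> hdom (Phi \<Theta> X0) X"
      then show "h X a \<in> hdom L X" using hv cl by (auto simp: Phi_simps)
    qed (auto simp: h_def)
  qed (auto simp: Phi_simps Phi_ops hv cl)
  moreover have "h1 = h2" if h: "halmos_hom \<Theta> X0 (Phi \<Theta> X0) L h1" "halmos_hom \<Theta> X0 (Phi \<Theta> X0) L h2" for h1 h2
  proof (rule PiE_ext)
    show "h1 \<in> (\<Pi>\<^sub>E X \<in> Gams X0. hdom (Phi \<Theta> X0) X \<rightarrow>\<^sub>E hdom L X)"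
      "h2 \<in> (\<Pi>\<^sub>E X \<in> Gams X0. hdom (Phi \<Theta> X0) X \<rightarrow>\<^sub>E hdom L X)" using h by (auto simp: halmos_hom_def)
    fix X assume X: "X \<in> Gams X0"
    show "h1 X = h2 X"
    proof (rule PiE_ext)
      show "h1 X \<in> hdom (Phi \<Theta> X0) X \<rightarrow>\<^sub>E hdom L X" "h2 X \<in> hdom (Phi \<Theta> X0) X \<rightarrow>\<^sub>E hdom L X"
        using halmos_homD(1)[OF h(1) X] halmos_homD(1)[OF h(2) X] .
    next
      fix a assume "a \<in> hdom (Phi \<Theta> X0) X"
      then obtain p where "of_sort \<Theta> X0 p X" "a = hcls \<Theta> X0 X p" by (auto simp: Phi_simps)
      then show "h1 X a = h2 X a" using ev[OF h(1) X] ev[OF h(2) X] by metis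
    qed
  qed
  ultimately show "\<exists>!h. halmos_hom \<Theta> X0 (Phi \<Theta> X0) L h" by blast
qed

end

(* A point \<mu> satisfies s_* u iff the point \<mu> \<circ> s of W(X0) satisfies u. By the Tarskian description
   of Val on first-order formulas, this says that u holds in H under the assignment
   x \<mapsto> \<mu>(s(x)). As s fixes X, this assignment agrees with \<mu> on X, hence on the free
   variables of u. *)

theory Submission
  imports Defs
begin

text \<open>Coincidence lemma. The assignments compared below come from extensional functions and
  are known to agree only on the variables that matter; this lemma discards their values
  elsewhere.\<close>

lemma sat_cong:
  "(\<And>x. x \<in> free_vars \<phi> \<Longrightarrow> \<rho> x = \<rho>' x) \<Longrightarrow> sat H \<rho> \<phi> \<longleftrightarrow> sat H \<rho>' \<phi>"
proof (induction \<phi> arbitrary: \<rho> \<rho>')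
  case (FEq t t')
  have "evalt (interp H) \<rho> t = evalt (interp H) \<rho>' t" "evalt (interp H) \<rho> t' = evalt (interp H) \<rho>' t'"
    by (rule evalt_cong; use FEq in simp)+
  then show ?case by simp
next
  case (FNeg \<phi>)
  have "sat H \<rho> \<phi> \<longleftrightarrow> sat H \<rho>' \<phi>" by (rule FNeg.IH) (use FNeg.prems in auto)
  then show ?case by (simp only: sat.simps)
next
  case (FAnd \<phi> \<psi>)
  have "sat H \<rho> \<phi> \<longleftrightarrow> sat H \<rho>' \<phi>" by (rule FAnd.IH(1)) (use FAnd.prems in auto)
  moreover have "sat H \<rho> \<psi> \<longleftrightarrow> sat H \<rho>' \<psi>" by (rule FAnd.IH(2)) (use FAnd.prems in auto)
  ultimately show ?case by (simp only: sat.simps)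
next
  case (FOr \<phi> \<psi>)
  have "sat H \<rho> \<phi> \<longleftrightarrow> sat H \<rho>' \<phi>" by (rule FOr.IH(1)) (use FOr.prems in auto)
  moreover have "sat H \<rho> \<psi> \<longleftrightarrow> sat H \<rho>' \<psi>" by (rule FOr.IH(2)) (use FOr.prems in auto)
  ultimately show ?case by (simp only: sat.simps)
next
  case (FEx x \<phi>)
  have "sat H (\<rho>(x := a)) \<phi> = sat H (\<rho>'(x := a)) \<phi>" for a
    by (rule FEx.IH) (use FEx.prems in auto)
  then show ?case by simp
qed simp_all

lemma free_vars_fo_over: "fo_over \<Theta> V \<phi> \<Longrightarrow> free_vars \<phi> \<subseteq> V"
  by (induction \<phi>) (auto dest!: tvars_Tm)

lemma of_sort_fo_hterm: "fo_over \<Theta> V \<phi> \<Longrightarrow> of_sort \<Theta> X0 (fo_hterm \<Theta> V \<phi>) V"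
  by (induction \<phi>) (auto simp: carr_W)

text \<open>Tarski semantics of \<open>Hal\<close> on first-order terms. Connectives are set
  operations and equalities are \<open>Hom_eval\<close>. In the quantifier case, points agreeing
  with \<open>\<eta>\<close> off \<open>x\<close> correspond to new values at \<open>x\<close>,
  because \<open>W \<Theta> V\<close> is free.\<close>

lemma heval_fo_hterm:
  assumes v: "is_variety \<Theta>" and H: "in_variety \<Theta> H"
  shows "fo_over \<Theta> V \<phi> \<Longrightarrow> \<eta> \<in> Hom \<Theta> (W \<Theta> V) H \<Longrightarrow>
    \<eta> \<in> heval (Hal \<Theta> H) (fo_hterm \<Theta> V \<phi>) V \<longleftrightarrow> sat H (\<lambda>x. \<eta> (gen \<Theta> V x)) \<phi>"
proof (induction \<phi> arbitrary: \<eta>)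
  case (FEq t t')
  then show ?case by (simp add: Hom_eval[OF v])
next
  case (FEx x \<phi>)
  let ?E = "heval (Hal \<Theta> H) (fo_hterm \<Theta> V \<phi>) V"
  have x: "x \<in> V" and \<phi>: "fo_over \<Theta> V \<phi>" using FEx.prems by simp_all
  \<comment> \<open>The two assignments are only known to agree on \<open>V\<close>, which contains
    the free variables of \<open>\<phi>\<close>.\<close>
  have upd: "\<nu> \<in> ?E \<longleftrightarrow> sat H ((\<lambda>z. \<eta> (gen \<Theta> V z))(x := \<nu> (gen \<Theta> V x))) \<phi>"
    if "\<nu> \<in> Hom \<Theta> (W \<Theta> V) H" "agree_off \<Theta> V x \<eta> \<nu>" for \<nu>
    unfolding FEx.IH[OF \<phi> that(1)]
    by (rule sat_cong) (use that free_vars_fo_over[OF \<phi>] in \<open>auto simp: agree_off_def\<close>)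
  have "(\<exists>\<nu> \<in> ?E. agree_off \<Theta> V x \<eta> \<nu>) \<longleftrightarrow>
      (\<exists>a \<in> carr H. sat H ((\<lambda>z. \<eta> (gen \<Theta> V z))(x := a)) \<phi>)"
  proof
    assume "\<exists>\<nu> \<in> ?E. agree_off \<Theta> V x \<eta> \<nu>"
    then obtain \<nu> where \<nu>: "\<nu> \<in> ?E" "agree_off \<Theta> V x \<eta> \<nu>" by blast
    \<comment> \<open>Needed because \<open>upd\<close> speaks only of homomorphisms. Closure is
      applied with \<open>V\<close> itself as the full variable set, so that \<open>V\<close> is a
      sort.\<close>
    have "?E \<subseteq> Hom \<Theta> (W \<Theta> V) H"
      using heval_closed[OF Hal_halmos[OF v H] of_sort_fo_hterm[OF \<phi>], of V] by (simp add: Gams_def)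
    with \<nu> have h: "\<nu> \<in> Hom \<Theta> (W \<Theta> V) H" by blast
    show "\<exists>a \<in> carr H. sat H ((\<lambda>z. \<eta> (gen \<Theta> V z))(x := a)) \<phi>"
      using upd[OF h \<nu>(2)] \<nu>(1) Hom_carr[OF h gen_W[OF x]] by blast
  next
    assume "\<exists>a \<in> carr H. sat H ((\<lambda>z. \<eta> (gen \<Theta> V z))(x := a)) \<phi>"
    then obtain a where a: "a \<in> carr H" "sat H ((\<lambda>z. \<eta> (gen \<Theta> V z))(x := a)) \<phi>" by blast
    \<comment> \<open>Freeness turns the modified assignment into a point.\<close>
    obtain \<nu> where \<nu>: "\<nu> \<in> Hom \<Theta> (W \<Theta> V) H"
        "\<And>z. z \<in> V \<Longrightarrow> \<nu> (gen \<Theta> V z) = ((\<lambda>z. \<eta> (gen \<Theta> V z))(x := a)) z"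
      by (rule Hom_extend[OF v H, of V "(\<lambda>z. \<eta> (gen \<Theta> V z))(x := a)"])
        (use a(1) Hom_carr[OF FEx.prems(2) gen_W] in auto)
    then have off: "agree_off \<Theta> V x \<eta> \<nu>" by (simp add: agree_off_def)
    show "\<exists>\<nu> \<in> ?E. agree_off \<Theta> V x \<eta> \<nu>" 
      using upd[OF \<nu>(1) off] a(2) by (intro bexI[of _ \<nu>] off) (simp add: \<nu>(2)[OF x])
  qed
  then show ?case using FEx.prems by simp
qed auto

text \<open>\<open>Val\<close> is a definite description; since \<open>Phi\<close> is free and
  \<open>Hal\<close> is a Halmos algebra, it denotes the unique homomorphism, which is computed by
  evaluating any representing term.\<close>

lemma Val_hcls:
  assumes v: "is_variety \<Theta>" and H: "in_variety \<Theta> H" and "X \<in> Gams X0" "of_sort \<Theta> X0 p X"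
  shows "Val \<Theta> X0 H X (hcls \<Theta> X0 X p) = heval (Hal \<Theta> H) p X"
proof -
  note L = Hal_halmos[OF v H, of X0]
  have "halmos_hom \<Theta> X0 (Phi \<Theta> X0) (Hal \<Theta> H) (Val \<Theta> X0 H)"
    unfolding Val_def by (rule theI'[OF Phi_free(1)[OF v L]])
  then show ?thesis using Phi_free(2)[OF v L] assms(3,4) by blast
qed

text \<open>In \<open>Hal\<close> the operation of \<open>s\<close> is the preimage under
  composition with \<open>s\<close>, so satisfaction of the substituted formula at
  \<open>\<mu>\<close> moves to the point \<open>\<mu>\<close> after \<open>s\<close>.\<close>

lemma LKer_hsub_fo_hterm:
  assumes v: "is_variety \<Theta>" and H: "in_variety \<Theta> H" and X: "X \<in> Gams X0"
    and s: "s \<in> Hom \<Theta> (W \<Theta> X0) (W \<Theta> X)" and \<mu>: "\<mu> \<in> Hom \<Theta> (W \<Theta> X) H" and \<phi>: "fo_over \<Theta> X0 \<phi>"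
  shows "hsub (Phi \<Theta> X0) X0 X s (hcls \<Theta> X0 X0 (fo_hterm \<Theta> X0 \<phi>)) \<in> LKer \<Theta> X0 H X \<mu> \<longleftrightarrow>
    sat H (\<lambda>x. \<mu> (s (gen \<Theta> X0 x))) \<phi>"
proof -
  let ?p = "fo_hterm \<Theta> X0 \<phi>" and ?\<eta> = "compose (carr (W \<Theta> X0)) \<mu> s"
  have X0: "X0 \<in> Gams X0" by (simp add: Gams_def)
  note p = of_sort_fo_hterm[OF \<phi>]
  have sp: "of_sort \<Theta> X0 (HSub X0 s ?p) X" using X0 s p by simp
  have "hsub (Phi \<Theta> X0) X0 X s (hcls \<Theta> X0 X0 ?p) \<in> LKer \<Theta> X0 H X \<mu> \<longleftrightarrow>
      hcls \<Theta> X0 X (HSub X0 s ?p) \<in> LKer \<Theta> X0 H X \<mu>"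
    by (simp only: Phi_ops(5)[OF X0 p X s])
  also have "\<dots> \<longleftrightarrow> \<mu> \<in> heval (Hal \<Theta> H) (HSub X0 s ?p) X"
    using sp unfolding LKer_def Phi_simps mem_Collect_eq Val_hcls[OF v H X sp] by blast
  also have "\<dots> \<longleftrightarrow> ?\<eta> \<in> heval (Hal \<Theta> H) ?p X0" using \<mu> by simp
  also have "\<dots> \<longleftrightarrow> sat H (\<lambda>x. ?\<eta> (gen \<Theta> X0 x)) \<phi>"
    by (rule heval_fo_hterm[OF v H \<phi> Hom_compose[OF v s \<mu>]])
  also have "\<dots> \<longleftrightarrow> sat H (\<lambda>x. \<mu> (s (gen \<Theta> X0 x))) \<phi>"
    by (rule sat_cong) (use free_vars_fo_over[OF \<phi>] in \<open>auto intro: compose_gen\<close>)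
  finally show ?thesis .
qed

theorem theorem4p4:
  fixes \<Theta> :: "'f variety" and X0 X :: "'v set" and H :: "('f, 'h) alg"
    and s :: "('f, 'v) tm set \<Rightarrow> ('f, 'v) tm set" and u :: "('f, 'v) hterm set"
    and \<mu> :: "('f, 'v) tm set \<Rightarrow> 'h"
  assumes "is_variety \<Theta>"
    and "infinite X0"
    and "in_variety \<Theta> H"
    and "X \<in> Gam X0"
    and "special_hom \<Theta> X0 X s"
    and "special_formula \<Theta> X0 X u"
    and "\<mu> \<in> Hom \<Theta> (W \<Theta> X) H"
  shows "u \<in> Tp \<Theta> X0 H X \<mu> \<longleftrightarrow> hsub (Phi \<Theta> X0) X0 X s u \<in> LKer \<Theta> X0 H X \<mu>"
proof -
  have X: "X \<in> Gams X0" using assms(4) by (simp add: Gams_def)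
  have s: "s \<in> Hom \<Theta> (W \<Theta> X0) (W \<Theta> X)" and fix_X: "\<And>x. x \<in> X \<Longrightarrow> s (gen \<Theta> X0 x) = gen \<Theta> X x"
    using assms(5) by (auto simp: special_hom_def)
  \<comment> \<open>Shown for every special representative, as the right-hand side depends on
    \<open>u\<close> alone; hence the existential choice in \<open>Tp\<close> is harmless.\<close>
  have "sat H (\<lambda>x \<in> X. \<mu> (gen \<Theta> X x)) \<phi> \<longleftrightarrow> hsub (Phi \<Theta> X0) X0 X s u \<in> LKer \<Theta> X0 H X \<mu>"
    if "special_repr \<Theta> X0 X \<phi> u" for \<phi>
  proof -
    have \<phi>: "fo_over \<Theta> X0 \<phi>" "free_vars \<phi> \<subseteq> X" "u = hcls \<Theta> X0 X0 (fo_hterm \<Theta> X0 \<phi>)"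
      using that by (auto simp: special_repr_def)
    \<comment> \<open>On \<open>X\<close> both assignments give \<open>\<mu>\<close> of the
      generator since \<open>s\<close> fixes \<open>X\<close>; off \<open>X\<close> the left one is
      \<open>undefined\<close>, but no free variable of \<open>\<phi>\<close> lies there.\<close>
    have "sat H (\<lambda>x \<in> X. \<mu> (gen \<Theta> X x)) \<phi> \<longleftrightarrow> sat H (\<lambda>x. \<mu> (s (gen \<Theta> X0 x))) \<phi>"
      by (rule sat_cong) (use \<phi>(2) fix_X in auto)
    then show ?thesis
      unfolding \<phi>(3) LKer_hsub_fo_hterm[OF assms(1,3) X s assms(7) \<phi>(1)] .
  qed
  then show ?thesis using assms(6) by (auto simp: Tp_def special_formula_def)
qed

end
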